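(* There exists a planar graph $G$ such that every straight-line drawing of $G$ in $\mathbb{R}^2$ whose vertices and edges are contained in the union of $\rho^1_2(G)$ lines has at least one vertex with an irrational coordinate. *)

theory Defs
  imports "HOL-Analysis.Analysis"
begin

type_synonym point = "real \<times> real"

definition simple_graph :: "nat set \<Rightarrow> nat set set \<Rightarrow> bool" where
  "simple_graph V E \<longleftrightarrow> finite V \<and>
     (\<forall>e\<in>E. \<exists>u v. u \<noteq> v \<and> u \<in> V \<and> v \<in> V \<and> e = {u, v})"

definition planar_graph :: "nat set \<Rightarrow> nat set set \<Rightarrow> bool" where
  "planar_graph V E \<longleftrightarrow> (\<exists>(pos :: nat \<Rightarrow> point) (\<gamma> :: nat set \<Rightarrow> real \<Rightarrow> point).
     inj_on pos V \<and>
     (\<forall>e\<in>E. arc (\<gamma> e) \<and> {pathstart (\<gamma> e), pathfinish (\<gamma> e)} = pos ` e \<and>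
              path_image (\<gamma> e) \<inter> pos ` V = pos ` e) \<and>
     (\<forall>e1\<in>E. \<forall>e2\<in>E. e1 \<noteq> e2 \<longrightarrow>
        path_image (\<gamma> e1) \<inter> path_image (\<gamma> e2) \<subseteq> pos ` (e1 \<inter> e2)))"

definition edge_seg :: "(nat \<Rightarrow> point) \<Rightarrow> nat set \<Rightarrow> point set" where
  "edge_seg pos e = convex hull (pos ` e)"

definition straight_line_drawing :: "nat set \<Rightarrow> nat set set \<Rightarrow> (nat \<Rightarrow> point) \<Rightarrow> bool" where
  "straight_line_drawing V E pos \<longleftrightarrow>
     inj_on pos V \<and>
     (\<forall>e\<in>E. \<forall>w\<in>V. pos w \<in> edge_seg pos e \<longrightarrow> w \<in> e) \<and>
     (\<forall>e1\<in>E. \<forall>e2\<in>E. e1 \<noteq> e2 \<longrightarrow>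
        edge_seg pos e1 \<inter> edge_seg pos e2 \<subseteq> pos ` (e1 \<inter> e2))"

definition line :: "point set \<Rightarrow> bool" where
  "line L \<longleftrightarrow> (\<exists>p d. d \<noteq> 0 \<and> L = {p + t *\<^sub>R d | t. True})"

definition on_k_lines :: "nat set \<Rightarrow> nat set set \<Rightarrow> (nat \<Rightarrow> point) \<Rightarrow> nat \<Rightarrow> bool" where
  "on_k_lines V E pos k \<longleftrightarrow> (\<exists>Ls. finite Ls \<and> card Ls = k \<and> (\<forall>L\<in>Ls. line L) \<and>
     pos ` V \<subseteq> \<Union>Ls \<and> (\<forall>e\<in>E. edge_seg pos e \<subseteq> \<Union>Ls))"

definition rho12 :: "nat set \<Rightarrow> nat set set \<Rightarrow> nat" where
  "rho12 V E = (LEAST k. \<exists>pos. straight_line_drawing V E pos \<and> on_k_lines V E pos k)"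

end

theory Submission
  imports Defs
begin

text \<open>The graph is the skeleton of the ten lines formed by the sides and the symmetry axes of a
  regular pentagon: its vertices are the 16 crossing points and its edges the bounded segments
  between neighbouring crossing points. A vertex on \<open>m\<close> of the lines of a drawing accounts for
  \<open>m (m - 1)\<close> ordered pairs of lines, and degrees and triangles force these numbers to add up to at
  least 90. Hence ten lines are necessary, and with ten lines all the estimates are tight, which
  pins down every incidence of the original arrangement. Taking the centre as origin and dualising,
  the five sides become a pentagon whose sides are parallel to its diagonals. The ratio of diagonal to
  side in such a pentagon is the golden ratio, so it has no rational coordinates.\<close>

section \<open>Lines through the vertices of a drawing\<close>

text \<open>The bound 90 is \<open>20 + 5 * (6 + 2 + 6)\<close>: five lines at the centre and, for
  each index, three at a pentagon vertex and two and three at \<open>mid i\<close> and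
  \<open>tip i\<close> in some order. As 90 is \<open>10 * 9\<close>, an upper bound of ten for
  \<open>rho12\<close> already forces equality. The obstacle is that a drawing need not resemble the
  original figure. Apart from each other, \<open>mid i\<close> and \<open>tip i\<close> have the
  same neighbours except for the centre, so they may swap places; the proof therefore collects
  incidences instead of relying on a given order along the lines. The centre is the right origin for
  the duality because lines through it turn into directions. Each axis carries two crossings of
  sides, and hence makes two differences of dual points parallel: one side and one diagonal of the
  dual pentagon. In the explicit drawing the basis vectors are half of \<open>pent 0\<close> and
  half of \<open>pent 1\<close>. Consecutive vertices of a regular pentagon satisfy v(k+1) + v(k-1)
  = \<open>inv_phi\<close> v(k), so all vertices have coordinates of the form
  \<open>gold a b\<close>; the factor 2 keeps midpoints integral, and each tip is
  \<open>2 * (1 + inv_phi)\<close> times its midpoint.\<close>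

lemma line_eqI:
  assumes "line L" "line L'" "a \<in> L" "b \<in> L" "a \<in> L'" "b \<in> L'" "a \<noteq> b"
  shows "L = L'"
proof -
  have *: "L = {a + t *\<^sub>R (b - a) | t. True}" if L: "line L" "a \<in> L" "b \<in> L" for L
  proof -
    obtain p d where d: "d \<noteq> 0" "L = {p + t *\<^sub>R d | t. True}"
      using L(1) unfolding line_def by blast
    obtain s t where s: "a = p + s *\<^sub>R d" and t: "b = p + t *\<^sub>R d"
      using L d(2) by blast
    have st: "t - s \<noteq> 0" using s t assms(7) by auto
    show ?thesis
    proof (intro set_eqI iffI)
      fix x assume "x \<in> L"
      then obtain r where r: "x = p + r *\<^sub>R d" using d(2) by blast
      have "b - a = (t - s) *\<^sub>R d" unfolding s t by (simp add: algebra_simps)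
      then have "((r - s) / (t - s)) *\<^sub>R (b - a) = (r - s) *\<^sub>R d" using st by simp
      then have "x = a + ((r - s) / (t - s)) *\<^sub>R (b - a)"
        unfolding r s by (simp add: algebra_simps)
      then show "x \<in> {a + t *\<^sub>R (b - a) | t. True}" by blast
    next
      fix x assume "x \<in> {a + t *\<^sub>R (b - a) | t. True}"
      then obtain r where "x = a + r *\<^sub>R (b - a)" by blast
      then have "x = p + (s + r * (t - s)) *\<^sub>R d"
        unfolding s t by (simp add: algebra_simps)
      then show "x \<in> L" unfolding d(2) by blast
    qed
  qed
  show ?thesis using *[of L] *[of L'] assms by metis
qed

lemma closed_segment_subset_line:
  assumes "line L" "a \<in> L" "b \<in> L"
  shows "closed_segment a b \<subseteq> L"
proof
  fix x assume "x \<in> closed_segment a b"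
  then obtain u where u: "x = (1 - u) *\<^sub>R a + u *\<^sub>R b" by (auto simp: closed_segment_def)
  obtain p d where d: "L = {p + t *\<^sub>R d | t. True}"
    using assms(1) unfolding line_def by blast
  obtain s t where "a = p + s *\<^sub>R d" "b = p + t *\<^sub>R d"
    using assms d by blast
  then have "x = p + ((1 - u) * s + u * t) *\<^sub>R d" unfolding u by (simp add: algebra_simps)
  then show "x \<in> L" unfolding d by blast
qed

text \<open>Finitely many lines cover infinitely many points, so one of them contains two points of
  the segment and is the line through \<open>a\<close> and \<open>b\<close>.\<close>

lemma segment_in_one_line:
  assumes "finite Ls" "\<forall>L\<in>Ls. line L" "closed_segment a b \<subseteq> \<Union>Ls" "a \<noteq> b"
  shows "\<exists>L\<in>Ls. a \<in> L \<and> b \<in> L"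
proof -
  have "infinite (closed_segment a b)" using assms(4) by simp
  moreover have "closed_segment a b = (\<Union>L\<in>Ls. closed_segment a b \<inter> L)" using assms(3) by blast
  ultimately obtain L where L: "L \<in> Ls" "infinite (closed_segment a b \<inter> L)"
    using assms(1) by (metis (no_types, lifting) finite_UN_I)
  then obtain x where x: "x \<in> closed_segment a b \<inter> L"
    by (metis all_not_in_conv finite.emptyI)
  have "infinite (closed_segment a b \<inter> L - {x})" using L(2) by simp
  then obtain y where y: "y \<in> closed_segment a b \<inter> L" "y \<noteq> x"
    by (metis Diff_iff all_not_in_conv finite.emptyI insertI1)
  define D where "D = {a + t *\<^sub>R (b - a) | t. True}"
  have D: "line D" using assms(4) unfolding line_def D_def by (intro exI[of _ a] exI[of _ "b - a"]) simp
  have ab: "a \<in> D" "b \<in> D"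
    unfolding D_def by (auto intro: exI[of _ 0] exI[of _ 1])
  have "x \<in> D" "y \<in> D" using closed_segment_subset_line[OF D ab] x y by auto
  then have "D = L"
    using line_eqI[OF D, of L x y] x y L(1) assms(2) by auto
  then show ?thesis using ab L(1) by blast
qed

lemma edge_seg_doubleton: "edge_seg pos {u, v} = closed_segment (pos u) (pos v)"
  unfolding edge_seg_def by (simp add: segment_convex_hull)

locale line_cover =
  fixes V :: "nat set" and E :: "nat set set" and pos :: "nat \<Rightarrow> point" and Ls :: "point set set"
  assumes graph: "simple_graph V E"
    and drawing: "straight_line_drawing V E pos"
    and finite_lines: "finite Ls"
    and lines: "\<And>L. L \<in> Ls \<Longrightarrow> line L"
    and covered: "\<And>e. e \<in> E \<Longrightarrow> edge_seg pos e \<subseteq> \<Union>Ls"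
begin

lemma finite_V: "finite V"
  using graph by (simp add: simple_graph_def)

lemma edge_vertices: "{u, v} \<in> E \<Longrightarrow> u \<in> V \<and> v \<in> V \<and> u \<noteq> v"
  using graph unfolding simple_graph_def by (metis doubleton_eq_iff)

lemma pos_eq_iff: "u \<in> V \<Longrightarrow> v \<in> V \<Longrightarrow> pos u = pos v \<longleftrightarrow> u = v"
  using drawing unfolding straight_line_drawing_def by (meson inj_on_eq_iff)

lemma vertex_on_edge: "{u, v} \<in> E \<Longrightarrow> w \<in> V \<Longrightarrow> pos w \<in> closed_segment (pos u) (pos v) \<Longrightarrow> w = u \<or> w = v"
  using drawing edge_seg_doubleton unfolding straight_line_drawing_def by (metis insert_iff singletonD)

lemma line_of_edge:
  assumes "{u, v} \<in> E"
  obtains L where "L \<in> Ls" "pos u \<in> L" "pos v \<in> L"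
  using segment_in_one_line[OF finite_lines, of "pos u" "pos v"] lines covered[OF assms]
    edge_vertices[OF assms] pos_eq_iff edge_seg_doubleton by auto

lemma lines_eqI:
  assumes "L \<in> Ls" "L' \<in> Ls" "u \<in> V" "v \<in> V" "u \<noteq> v"
    and "pos u \<in> L" "pos v \<in> L" "pos u \<in> L'" "pos v \<in> L'"
  shows "L = L'"
  using line_eqI[of L L' "pos u" "pos v"] assms lines pos_eq_iff by blast

text \<open>If both neighbours were on the same side of \<open>v\<close>, the nearer one would lie
  inside the edge to the farther one, which a drawing forbids.\<close>

lemma opposite_neighbours:
  assumes "{v, a} \<in> E" "{v, b} \<in> E" "a \<noteq> b"
    and "pos v = p + r *\<^sub>R d" "pos a = p + s *\<^sub>R d" "pos b = p + t *\<^sub>R d"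
  shows "(s - r) * (t - r) < 0"
proof (rule ccontr)
  assume "\<not> (s - r) * (t - r) < 0"
  moreover have "s \<noteq> r" "t \<noteq> r" "s \<noteq> t"
    using assms edge_vertices pos_eq_iff by metis+
  ultimately consider "r < s" "s < t" | "r < t" "t < s" | "s < r" "t < s" | "t < r" "s < t"
    by (smt (verit) mult_neg_pos mult_pos_neg)
  note cs = this
  have betw: "p + y *\<^sub>R d \<in> closed_segment (p + x *\<^sub>R d) (p + z *\<^sub>R d)"
    if "x < y \<and> y < z \<or> z < y \<and> y < x" for x y z :: real
  proof -
    have "(1 - (y - x) / (z - x)) * x + (y - x) / (z - x) * z = y"
      using that by (auto simp: divide_simps) (auto simp: algebra_simps)
    moreover have "(1 - c) *\<^sub>R (p + x *\<^sub>R d) + c *\<^sub>R (p + z *\<^sub>R d) = p + ((1 - c) * x + c * z) *\<^sub>R d" for c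
      by (simp add: algebra_simps)
    ultimately have "p + y *\<^sub>R d = (1 - (y - x) / (z - x)) *\<^sub>R (p + x *\<^sub>R d) + ((y - x) / (z - x)) *\<^sub>R (p + z *\<^sub>R d)"
      by metis
    moreover have "0 \<le> (y - x) / (z - x)" "(y - x) / (z - x) \<le> 1"
      using that by (auto simp: divide_simps)
    ultimately show ?thesis unfolding closed_segment_def by blast
  qed
  have "pos a \<in> closed_segment (pos v) (pos b) \<or> pos b \<in> closed_segment (pos v) (pos a)"
    unfolding assms(4-6) by (rule cs) (use betw in auto)
  then show False
    using vertex_on_edge assms edge_vertices by metis
qed

text \<open>Each of the three vertices would have to lie strictly between the other two. This is the
  main source of distinct lines at a vertex.\<close>

lemma no_collinear_triangle:
  assumes "{u, v} \<in> E" "{v, w} \<in> E" "{u, w} \<in> E"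
    and "L \<in> Ls" "pos u \<in> L" "pos v \<in> L" "pos w \<in> L"
  shows False
proof -
  obtain p d where d: "L = {p + t *\<^sub>R d | t. True}"
    using lines[OF assms(4)] unfolding line_def by blast
  obtain r s t where t: "pos u = p + r *\<^sub>R d" "pos v = p + s *\<^sub>R d" "pos w = p + t *\<^sub>R d"
    using assms d by blast
  have ne: "u \<noteq> v" "v \<noteq> w" "u \<noteq> w" using assms(1-3) edge_vertices by blast+
  have vu: "{v, u} \<in> E" and wu: "{w, u} \<in> E" and wv: "{w, v} \<in> E"
    using assms(1-3) by (auto simp: insert_commute)
  have "(s - r) * (t - r) < 0" "(r - s) * (t - s) < 0" "(r - t) * (s - t) < 0"
    using opposite_neighbours[OF assms(1,3) ne(2) t] opposite_neighbours[OF vu assms(2) ne(3) t(2,1,3)]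
      opposite_neighbours[OF wu wv ne(1) t(3,1,2)] by auto
  then show False by (auto simp: mult_less_0_iff)
qed

lemma at_most_two_neighbours:
  assumes "{v, a} \<in> E" "{v, b} \<in> E" "{v, c} \<in> E" "a \<noteq> b" "b \<noteq> c" "a \<noteq> c"
    and "L \<in> Ls" "pos v \<in> L" "pos a \<in> L" "pos b \<in> L" "pos c \<in> L"
  shows False
proof -
  obtain p d where d: "L = {p + t *\<^sub>R d | t. True}"
    using lines[OF assms(7)] unfolding line_def by blast
  obtain r s t x where t: "pos v = p + x *\<^sub>R d" "pos a = p + r *\<^sub>R d" "pos b = p + s *\<^sub>R d" "pos c = p + t *\<^sub>R d"
    using assms d by blast
  have "(r - x) * (s - x) < 0" "(s - x) * (t - x) < 0" "(r - x) * (t - x) < 0"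
    using opposite_neighbours[OF assms(1,2,4) t(1,2,3)] opposite_neighbours[OF assms(2,3,5) t(1,3,4)]
      opposite_neighbours[OF assms(1,3,6) t(1,2,4)] by auto
  then show False by (auto simp: mult_less_0_iff)
qed

definition pencil :: "nat \<Rightarrow> point set set" where
  "pencil v = {L \<in> Ls. pos v \<in> L}"

lemma finite_pencil: "finite (pencil v)"
  using finite_lines by (simp add: pencil_def)

text \<open>Every edge at \<open>v\<close> runs along a line of the pencil, and each such line takes
  at most two of them.\<close>

lemma card_pencil_ge:
  assumes "finite N" "\<And>a. a \<in> N \<Longrightarrow> {v, a} \<in> E"
  shows "card N \<le> 2 * card (pencil v)"
proof -
  have "N \<subseteq> (\<Union>L\<in>pencil v. {a \<in> N. pos a \<in> L})"
  proof
    fix a assume "a \<in> N"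
    then obtain L where "L \<in> Ls" "pos v \<in> L" "pos a \<in> L" using line_of_edge assms(2) by metis
    then show "a \<in> (\<Union>L\<in>pencil v. {a \<in> N. pos a \<in> L})" using \<open>a \<in> N\<close> unfolding pencil_def by blast
  qed
  then have "card N \<le> card (\<Union>L\<in>pencil v. {a \<in> N. pos a \<in> L})"
    using assms(1) finite_pencil by (intro card_mono) auto
  also have "\<dots> \<le> (\<Sum>L\<in>pencil v. card {a \<in> N. pos a \<in> L})"
    by (rule card_UN_le[OF finite_pencil])
  also have "\<dots> \<le> (\<Sum>L\<in>pencil v. 2)"
  proof (rule sum_mono, rule ccontr)
    fix L assume L: "L \<in> pencil v" "\<not> card {a \<in> N. pos a \<in> L} \<le> 2"
    then have "3 \<le> card {a \<in> N. pos a \<in> L}" by simp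
    then obtain T where "T \<subseteq> {a \<in> N. pos a \<in> L}" "card T = 3"
      by (meson obtain_subset_with_card_n)
    then obtain a b c where "{a, b, c} \<subseteq> {a \<in> N. pos a \<in> L}" "a \<noteq> b" "b \<noteq> c" "a \<noteq> c"
      by (metis card_3_iff)
    then show False
      using at_most_two_neighbours[of v a b c L] assms(2) L(1) unfolding pencil_def by auto
  qed
  finally show ?thesis by simp
qed

definition crossings :: "nat \<Rightarrow> (point set \<times> point set) set" where
  "crossings v = {(L, L'). L \<in> pencil v \<and> L' \<in> pencil v \<and> L \<noteq> L'}"

lemma card_off_diagonal:
  assumes "finite A"
  shows "card {(x, y). x \<in> A \<and> y \<in> A \<and> x \<noteq> y} = card A * (card A - 1)"
proof -
  have "{(x, y). x \<in> A \<and> y \<in> A \<and> x \<noteq> y} = (SIGMA x:A. A - {x})" by auto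
  then show ?thesis using assms by (simp add: card_SigmaI)
qed

lemma Union_crossings_subset:
  "(\<Union>v\<in>V. crossings v) \<subseteq> {(L, L'). L \<in> Ls \<and> L' \<in> Ls \<and> L \<noteq> L'}"
  by (auto simp: crossings_def pencil_def)

lemma card_Union_crossings:
  "card (\<Union>v\<in>V. crossings v) = (\<Sum>v\<in>V. card (pencil v) * (card (pencil v) - 1))"
proof -
  have fin: "finite (crossings v)" for v
    by (rule finite_subset[of _ "pencil v \<times> pencil v"]) (auto simp: crossings_def finite_pencil)
  \<comment> \<open>Two different lines share at most one vertex, so each pair is counted at a
    single vertex.\<close>
  have disj: "crossings u \<inter> crossings v = {}" if "u \<in> V" "v \<in> V" "u \<noteq> v" for u v
    using that lines_eqI unfolding crossings_def pencil_def by blast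
  have "card (\<Union>v\<in>V. crossings v) = (\<Sum>v\<in>V. card (crossings v))"
    using finite_V fin disj by (intro card_UN_disjoint) auto
  then show ?thesis
    unfolding crossings_def by (simp add: card_off_diagonal finite_pencil)
qed

lemma finite_line_pairs: "finite {(L, L'). L \<in> Ls \<and> L' \<in> Ls \<and> L \<noteq> L'}"
  by (rule finite_subset[of _ "Ls \<times> Ls"]) (auto simp: finite_lines)

lemma sum_pencils_le:
  "(\<Sum>v\<in>V. card (pencil v) * (card (pencil v) - 1)) \<le> card Ls * (card Ls - 1)"
  using card_mono[OF finite_line_pairs Union_crossings_subset]
  by (simp add: card_Union_crossings card_off_diagonal[OF finite_lines])

text \<open>The equality case of \<open>sum_pencils_le\<close>: the crossings at the vertices then
  exhaust all pairs of lines, so no two lines are parallel or cross away from a vertex.\<close>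

lemma lines_meet_in_vertex:
  assumes "card Ls * (card Ls - 1) \<le> (\<Sum>v\<in>V. card (pencil v) * (card (pencil v) - 1))"
    and "L \<in> Ls" "L' \<in> Ls" "L \<noteq> L'"
  shows "\<exists>v\<in>V. pos v \<in> L \<and> pos v \<in> L'"
proof -
  have "(\<Union>v\<in>V. crossings v) = {(L, L'). L \<in> Ls \<and> L' \<in> Ls \<and> L \<noteq> L'}"
    using assms(1) by (intro card_seteq[OF finite_line_pairs Union_crossings_subset])
      (simp add: card_Union_crossings card_off_diagonal[OF finite_lines])
  then have "(L, L') \<in> (\<Union>v\<in>V. crossings v)" using assms(2-4) by blast
  then show ?thesis by (auto simp: crossings_def pencil_def)
qed

end

section \<open>Pentagons with sides parallel to diagonals\<close>

lemma line_of_equation: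
  fixes u v c :: real
  assumes "u \<noteq> 0 \<or> v \<noteq> 0"
  shows "line {z :: point. u * fst z + v * snd z = c}"
proof -
  define n where "n = u\<^sup>2 + v\<^sup>2"
  have n: "n \<noteq> 0" using assms by (auto simp: n_def sum_power2_eq_zero_iff)
  \<comment> \<open>The foot of the perpendicular from the origin; \<open>d\<close> is the normal
    vector turned by a right angle.\<close>
  define p :: point where "p = (u * c / n, v * c / n)"
  define d :: point where "d = (- v, u)"
  have "{z :: point. u * fst z + v * snd z = c} = {p + t *\<^sub>R d | t. True}"
  proof (intro set_eqI iffI)
    fix z :: point assume "z \<in> {z. u * fst z + v * snd z = c}"
    then have z: "u * fst z + v * snd z = c" by simp
    have "fst z * n = u * c - (u * snd z - v * fst z) * v" "snd z * n = v * c + (u * snd z - v * fst z) * u"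
      unfolding z[symmetric] n_def by algebra+
    then have "fst z = u * c / n - ((u * snd z - v * fst z) / n) * v" "snd z = v * c / n + ((u * snd z - v * fst z) / n) * u"
      using n by (simp_all add: field_simps)
    then have "z = p + ((u * snd z - v * fst z) / n) *\<^sub>R d"
      unfolding p_def d_def by (intro prod_eqI) (simp_all)
    then show "z \<in> {p + t *\<^sub>R d | t. True}" by blast
  next
    fix z assume "z \<in> {p + t *\<^sub>R d | t. True}"
    then obtain t where t: "z = p + t *\<^sub>R d" by blast
    have "u * (u * c / n) + v * (v * c / n) = c"
    proof -
      have "u * (u * c / n) + v * (v * c / n) = c * (u\<^sup>2 + v\<^sup>2) / n"
        by (simp add: add_divide_distrib power2_eq_square algebra_simps)
      then show ?thesis using n by (metis n_def nonzero_mult_div_cancel_right)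
    qed
    then show "z \<in> {z. u * fst z + v * snd z = c}"
      by (simp add: t p_def d_def algebra_simps)
  qed
  moreover have "d \<noteq> 0" using assms by (auto simp: d_def zero_prod_def)
  ultimately show ?thesis unfolding line_def by blast
qed

text \<open>The pair \<open>(a, b)\<close> is the point dual to \<open>L\<close> with respect to the
  origin \<open>o'\<close>. Cramer's rule computes it from two points of \<open>L\<close>, hence
  within the rationals.\<close>

lemma rational_dual_coordinates:
  fixes o' z1 z2 :: point
  assumes "line L" "o' \<notin> L" "z1 \<in> L" "z2 \<in> L" "z1 \<noteq> z2"
    and rat: "fst o' \<in> \<rat>" "snd o' \<in> \<rat>" "fst z1 \<in> \<rat>" "snd z1 \<in> \<rat>" "fst z2 \<in> \<rat>" "snd z2 \<in> \<rat>"
  shows "\<exists>a b. a \<in> \<rat> \<and> b \<in> \<rat> \<and> L = {z. a * (fst z - fst o') + b * (snd z - snd o') = 1}"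
proof -
  define x1 y1 x2 y2 where xy: "x1 = fst z1 - fst o'" "y1 = snd z1 - snd o'" "x2 = fst z2 - fst o'" "y2 = snd z2 - snd o'"
  define D where "D = x1 * y2 - x2 * y1"
  have D: "D \<noteq> 0"
  proof
    assume "D = 0"
    \<comment> \<open>The parallel to the line through \<open>z1\<close> and \<open>z2\<close> that
      passes through \<open>o'\<close>; a vanishing \<open>D\<close> puts \<open>z1\<close> and
      \<open>z2\<close> on it, so it would be \<open>L\<close>.\<close>
    define K where "K = {z :: point. (y2 - y1) * fst z + (x1 - x2) * snd z = (y2 - y1) * fst o' + (x1 - x2) * snd o'}"
    have "line K" unfolding K_def using assms(5) by (intro line_of_equation) (auto simp: xy prod_eq_iff)
    moreover have "z1 \<in> K" "z2 \<in> K" "o' \<in> K"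
      using \<open>D = 0\<close> by (simp_all add: K_def D_def xy algebra_simps)
    ultimately show False using line_eqI[of L K z1 z2] assms by blast
  qed
  define a b where ab: "a = (y2 - y1) / D" "b = (x1 - x2) / D"
  define K where "K = {z :: point. a * fst z + b * snd z = 1 + a * fst o' + b * snd o'}"
  have K: "K = {z. a * (fst z - fst o') + b * (snd z - snd o') = 1}"
    unfolding K_def by (auto simp: algebra_simps)
  have "a * x1 + b * y1 = 1" "a * x2 + b * y2 = 1"
    using D by (simp_all add: ab divide_simps) (simp_all add: D_def algebra_simps)
  then have zK: "z1 \<in> K" "z2 \<in> K" by (simp_all add: K xy)
  have "a \<noteq> 0 \<or> b \<noteq> 0" using assms(5) D by (auto simp: ab xy prod_eq_iff)
  then have "line K" unfolding K_def by (rule line_of_equation)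
  then have "L = K" using line_eqI[of L K z1 z2] assms zK by blast
  moreover have "a \<in> \<rat>" "b \<in> \<rat>" using rat by (simp_all add: ab D_def xy)
  ultimately show ?thesis unfolding K by blast
qed

text \<open>If two lines meet in \<open>z\<close>, the difference of their dual points is orthogonal
  to \<open>z - o'\<close>. Since \<open>z\<close> and \<open>z'\<close> lie on one line
  \<open>K\<close> through \<open>o'\<close>, both differences are orthogonal to the direction of
  \<open>K\<close>.\<close>

lemma dual_parallel:
  fixes a1 b1 a2 b2 a3 b3 a4 b4 :: real and o' z z' :: point
  assumes "line K" "o' \<in> K" "z \<in> K" "z' \<in> K"
    and "a1 * (fst z - fst o') + b1 * (snd z - snd o') = 1" "a2 * (fst z - fst o') + b2 * (snd z - snd o') = 1"
    and "a3 * (fst z' - fst o') + b3 * (snd z' - snd o') = 1" "a4 * (fst z' - fst o') + b4 * (snd z' - snd o') = 1"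
  shows "(a1 - a2) * (b3 - b4) = (b1 - b2) * (a3 - a4)"
proof -
  obtain p d where d: "d \<noteq> 0" "K = {p + t *\<^sub>R d | t. True}"
    using assms(1) unfolding line_def by blast
  obtain r s t where t: "o' = p + r *\<^sub>R d" "z = p + s *\<^sub>R d" "z' = p + t *\<^sub>R d" using assms d by blast
  have "(s - r) * (a1 * fst d + b1 * snd d) = 1" "(s - r) * (a2 * fst d + b2 * snd d) = 1"
    "(t - r) * (a3 * fst d + b3 * snd d) = 1" "(t - r) * (a4 * fst d + b4 * snd d) = 1"
    using assms(5-8) unfolding t by (simp_all add: algebra_simps)
  then have "a1 * fst d + b1 * snd d = a2 * fst d + b2 * snd d" "a3 * fst d + b3 * snd d = a4 * fst d + b4 * snd d"
    by (metis mult_cancel_left mult_zero_left zero_neq_one)+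
  then have k: "(a1 - a2) * fst d + (b1 - b2) * snd d = 0" "(a3 - a4) * fst d + (b3 - b4) * snd d = 0"
    by (simp_all add: algebra_simps)
  then have "((a1 - a2) * (b3 - b4) - (b1 - b2) * (a3 - a4)) * fst d = 0"
    "((a1 - a2) * (b3 - b4) - (b1 - b2) * (a3 - a4)) * snd d = 0"
    by algebra+
  then show ?thesis using d(1) by (auto simp: prod_eq_iff)
qed

text \<open>A rational root of a monic integer polynomial is an integer, and
  \<open>m * (m - 1) = 1\<close> fails by parity.\<close>

lemma no_rational_golden_ratio:
  fixes t :: real
  assumes "t \<in> \<rat>" "t\<^sup>2 = t + 1"
  shows False
proof -
  obtain m n :: int where mn: "n > 0" "coprime m n" "t = of_int m / of_int n"
    using Rats_cases'[OF assms(1)] by metis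
  have "(of_int m)\<^sup>2 = (of_int (n * (m + n)) :: real)"
    using assms(2) mn(1) unfolding mn(3) by (simp add: field_simps power2_eq_square)
  then have eq: "m\<^sup>2 = n * (m + n)" by (metis of_int_eq_iff of_int_power)
  then have "n dvd m\<^sup>2" by simp
  moreover have "coprime (m\<^sup>2) n" using mn(2) by simp
  ultimately have "n = 1" using mn(1) by (metis coprime_common_divisor dvd_refl zdvd1_eq abs_of_pos)
  then have "m * (m - 1) = 1" using eq by (simp add: power2_eq_square algebra_simps)
  moreover have "even (m * (m - 1))" by simp
  ultimately show False by simp
qed

text \<open>Write P(i) for \<open>(a i, b i)\<close> and use the affine frame with origin P(0) and
  axes towards P(1) and P(4). Then \<open>par3\<close> and \<open>par2\<close> give P(2) = P(4) + t
  (P(1) - P(0)) and P(3) = P(1) + s (P(4) - P(0)), \<open>par0\<close> gives \<open>s = t\<close>,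
  and \<open>par1\<close> becomes the golden ratio equation for \<open>t\<close>, the ratio of a
  diagonal to its parallel side.\<close>

lemma no_rational_affine_regular_pentagon:
  fixes a b :: "nat \<Rightarrow> real"
  assumes rat: "\<And>i. a i \<in> \<rat>" "\<And>i. b i \<in> \<rat>"
    and par0: "(a 2 - a 3) * (b 4 - b 1) = (b 2 - b 3) * (a 4 - a 1)"
    and par1: "(a 3 - a 4) * (b 0 - b 2) = (b 3 - b 4) * (a 0 - a 2)"
    and par2: "(a 4 - a 0) * (b 1 - b 3) = (b 4 - b 0) * (a 1 - a 3)"
    and par3: "(a 0 - a 1) * (b 2 - b 4) = (b 0 - b 1) * (a 2 - a 4)"
    and nondeg: "(a 1 - a 0) * (b 4 - b 0) \<noteq> (b 1 - b 0) * (a 4 - a 0)"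
  shows False
proof -
  define D where "D = (a 1 - a 0) * (b 4 - b 0) - (b 1 - b 0) * (a 4 - a 0)"
  have D: "D \<noteq> 0" using nondeg by (simp add: D_def)
  define t where "t = ((a 2 - a 0) * (b 4 - b 0) - (b 2 - b 0) * (a 4 - a 0)) / D"
  define s where "s = ((a 1 - a 0) * (b 3 - b 0) - (b 1 - b 0) * (a 3 - a 0)) / D"
  have tD: "t * D = (a 2 - a 0) * (b 4 - b 0) - (b 2 - b 0) * (a 4 - a 0)"
   and sD: "s * D = (a 1 - a 0) * (b 3 - b 0) - (b 1 - b 0) * (a 3 - a 0)"
    using D by (simp_all add: t_def s_def)
  have "D * (a 2 - a 0) = D * ((a 4 - a 0) + t * (a 1 - a 0))" "D * (b 2 - b 0) = D * ((b 4 - b 0) + t * (b 1 - b 0))"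
    using tD par3 unfolding D_def by algebra+
  then have s2: "a 2 = a 4 + t * (a 1 - a 0)" "b 2 = b 4 + t * (b 1 - b 0)"
    using D by (simp_all)
  have "D * (a 3 - a 0) = D * ((a 1 - a 0) + s * (a 4 - a 0))" "D * (b 3 - b 0) = D * ((b 1 - b 0) + s * (b 4 - b 0))"
    using sD par2 unfolding D_def by algebra+
  then have s3: "a 3 = a 1 + s * (a 4 - a 0)" "b 3 = b 1 + s * (b 4 - b 0)"
    using D by (simp_all)
  have "D * (s - t) = 0" using par0 unfolding s2 s3 D_def by algebra
  then have st: "s = t" using D by simp
  have "D * (t\<^sup>2 - t - 1) = 0" using par1 unfolding s2 s3 st D_def by algebra
  then have "t\<^sup>2 = t + 1" using D by simp
  moreover have "t \<in> \<rat>" using rat by (simp add: t_def D_def)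
  ultimately show False by (rule no_rational_golden_ratio[rotated])
qed

section \<open>Drawings on ten lines\<close>

lemma mod5_shift: "0 < k \<Longrightarrow> k < 5 \<Longrightarrow> (i + k) mod 5 \<noteq> i mod 5" for i k :: nat
  using mod_eq_dvd_iff_nat[of i "i + k" 5] by (auto dest: dvd_imp_le)

text \<open>Vertices, edge midpoints, pentagram tips and centre of a pentagon, with indices modulo 5; both
  \<open>mid i\<close> and \<open>tip i\<close> belong to the edge from \<open>pent i\<close> to \<open>pent (i + 1)\<close>.\<close>

definition pent :: "nat \<Rightarrow> nat" where "pent i = i mod 5"
definition mid :: "nat \<Rightarrow> nat" where "mid i = 5 + i mod 5"
definition tip :: "nat \<Rightarrow> nat" where "tip i = 10 + i mod 5"
definition ctr :: nat where "ctr = 15"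

definition arr_V :: "nat set" where "arr_V = {..<16}"

definition arr_E :: "nat set set" where
  "arr_E = (\<Union>i<5. {{ctr, pent i}, {ctr, mid i}, {mid i, tip i}, {pent i, mid i},
     {pent (i + 1), mid i}, {pent i, tip i}, {pent (i + 1), tip i}})"

lemma arr_edges:
  "{ctr, pent i} \<in> arr_E" "{ctr, mid i} \<in> arr_E" "{mid i, tip i} \<in> arr_E"
  "{pent i, mid i} \<in> arr_E" "{pent (i + 1), mid i} \<in> arr_E"
  "{pent i, tip i} \<in> arr_E" "{pent (i + 1), tip i} \<in> arr_E"
proof -
  have "pent (i mod 5) = pent i" "pent (i mod 5 + 1) = pent (i + 1)" "mid (i mod 5) = mid i" "tip (i mod 5) = tip i"
    by (auto simp: pent_def mid_def tip_def mod_Suc_eq)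
  moreover have "i mod 5 < 5" by simp
  ultimately have "{{ctr, pent i}, {ctr, mid i}, {mid i, tip i}, {pent i, mid i},
     {pent (i + 1), mid i}, {pent i, tip i}, {pent (i + 1), tip i}} \<subseteq> arr_E"
    unfolding arr_E_def by (intro UN_upper[of "i mod 5" "{..<5}", THEN order_trans[rotated]]) auto
  then show "{ctr, pent i} \<in> arr_E" "{ctr, mid i} \<in> arr_E" "{mid i, tip i} \<in> arr_E"
    "{pent i, mid i} \<in> arr_E" "{pent (i + 1), mid i} \<in> arr_E"
    "{pent i, tip i} \<in> arr_E" "{pent (i + 1), tip i} \<in> arr_E"
    by simp_all
qed

lemma arr_vertices [simp]: "pent i \<in> arr_V" "mid i \<in> arr_V" "tip i \<in> arr_V" "ctr \<in> arr_V"
  by (auto simp: arr_V_def pent_def mid_def tip_def ctr_def intro: less_trans[of _ 5])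

lemma arr_distinct [simp]:
  "pent i \<noteq> mid j" "mid j \<noteq> pent i" "pent i \<noteq> tip j" "tip j \<noteq> pent i" "mid i \<noteq> tip j" "tip j \<noteq> mid i"
  "pent i \<noteq> ctr" "mid i \<noteq> ctr" "tip i \<noteq> ctr" "ctr \<noteq> pent i" "ctr \<noteq> mid i" "ctr \<noteq> tip i"
proof -
  have "i mod 5 < 5" "j mod 5 < 5" by simp_all
  then show "pent i \<noteq> mid j" "mid j \<noteq> pent i" "pent i \<noteq> tip j" "tip j \<noteq> pent i" "mid i \<noteq> tip j" "tip j \<noteq> mid i"
  "pent i \<noteq> ctr" "mid i \<noteq> ctr" "tip i \<noteq> ctr" "ctr \<noteq> pent i" "ctr \<noteq> mid i" "ctr \<noteq> tip i"
    by (auto simp: pent_def mid_def tip_def ctr_def)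
qed

lemma arr_V_eq: "arr_V = insert ctr (pent ` {..<5} \<union> mid ` {..<5} \<union> tip ` {..<5})"
  by (auto simp: arr_V_def pent_def mid_def tip_def ctr_def lessThan_nat_numeral lessThan_Suc)

lemma arr_V_cases:
  assumes "v \<in> arr_V"
  obtains "v = ctr" | i where "v = pent i" | i where "v = mid i" | i where "v = tip i"
  using assms unfolding arr_V_eq by blast

lemma sum_arr_V:
  fixes f :: "nat \<Rightarrow> nat"
  shows "sum f arr_V = f ctr + (\<Sum>i<5. f (pent i) + (f (mid i) + f (tip i)))"
  by (simp add: arr_V_def pent_def mid_def tip_def ctr_def lessThan_nat_numeral lessThan_Suc)

lemma arr_simple_graph: "simple_graph arr_V arr_E"
proof -
  have "pent (i + 1) \<noteq> pent i" for i unfolding pent_def by (rule mod5_shift) simp_all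
  show ?thesis
    unfolding simple_graph_def
  proof (intro conjI ballI)
    show "finite arr_V" by (simp add: arr_V_def)
    fix e assume "e \<in> arr_E"
    then obtain i where "e \<in> {{ctr, pent i}, {ctr, mid i}, {mid i, tip i}, {pent i, mid i},
     {pent (i + 1), mid i}, {pent i, tip i}, {pent (i + 1), tip i}}"
      unfolding arr_E_def by blast
    moreover have "\<exists>u v. u \<noteq> v \<and> u \<in> arr_V \<and> v \<in> arr_V \<and> {a, b} = {u, v}" if "a \<noteq> b" "a \<in> arr_V" "b \<in> arr_V" for a b
      using that by blast
    ultimately show "\<exists>u v. u \<noteq> v \<and> u \<in> arr_V \<and> v \<in> arr_V \<and> e = {u, v}"
      by (elim insertE emptyE) (simp_all only: arr_vertices arr_distinct not_False_eq_True)
  qed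
qed

lemma pronic_mono: "m \<le> n \<Longrightarrow> m * (m - 1) \<le> n * (n - 1)" for m n :: nat
  by (intro mult_le_mono diff_le_mono)

lemma pronic_bound:
  fixes n m :: nat assumes "n * (n - 1) \<le> m * (m - 1)" "2 \<le> m"  shows "n \<le> m"
proof (rule ccontr)
  assume "\<not> n \<le> m"
  then have "m + 1 \<le> n" by simp
  then have "(m + 1) * (m + 1 - 1) \<le> n * (n - 1)" by (rule pronic_mono)
  then have "(m + 1) * m \<le> m * (m - 1)" using assms(1) by simp
  then show False using assms(2) by (cases m) auto
qed

section \<open>Lower bounds for the number of lines at each vertex\<close>

locale ten_line_cover = line_cover arr_V arr_E pos Ls for pos Ls +
  assumes card_lines: "card Ls \<le> 10"
begin

text \<open>In a drawing, \<open>mid i\<close> and \<open>tip i\<close> may exchange their places. \<open>X i\<close> is the one between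
  \<open>pent i\<close> and \<open>pent (i + 1)\<close>; the other one, \<open>Y i\<close>, lies on three lines.\<close>

definition flipped :: "nat \<Rightarrow> bool" where
  "flipped i \<longleftrightarrow> (\<exists>L\<in>Ls. pos (pent i) \<in> L \<and> pos (pent (i + 1)) \<in> L \<and> pos (tip i) \<in> L)"

definition X :: "nat \<Rightarrow> nat" where "X i = (if flipped i then tip i else mid i)"
definition Y :: "nat \<Rightarrow> nat" where "Y i = (if flipped i then mid i else tip i)"

lemma XY_vertices [simp]: "X i \<in> arr_V" "Y i \<in> arr_V" "X i \<noteq> pent j" "Y i \<noteq> pent j" "pent j \<noteq> X i" "pent j \<noteq> Y i"
  "X i \<noteq> ctr" "Y i \<noteq> ctr" "ctr \<noteq> X i" "ctr \<noteq> Y i" "X i \<noteq> Y i" "Y i \<noteq> X i"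
  by (auto simp: X_def Y_def)

lemma XY_edges:
  "{X i, Y i} \<in> arr_E" "{Y i, X i} \<in> arr_E" "{X i, pent i} \<in> arr_E" "{X i, pent (i + 1)} \<in> arr_E"
  "{Y i, pent i} \<in> arr_E" "{Y i, pent (i + 1)} \<in> arr_E"
  using arr_edges[of i] by (auto simp: X_def Y_def insert_commute)

lemma XY_pent_not_collinear:
  assumes "L \<in> Ls" "pos (X i) \<in> L" "pos (Y i) \<in> L"
  shows "pos (pent i) \<notin> L" "pos (pent (i + 1)) \<notin> L"
  using no_collinear_triangle[OF XY_edges(1,5,3)] no_collinear_triangle[OF XY_edges(1,6,4)] assms by blast+

text \<open>If the line of the two pentagon vertices contains \<open>tip i\<close>, then
  \<open>Y i\<close> is \<open>mid i\<close>, and having it on the line too would flatten the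
  triangle of \<open>mid i\<close>, \<open>tip i\<close> and \<open>pent i\<close>. Otherwise
  \<open>Y i\<close> is \<open>tip i\<close>, which is off the line by the definition of
  \<open>flipped\<close>.\<close>

lemma Y_pents_not_collinear:
  assumes "L \<in> Ls" "pos (pent i) \<in> L" "pos (pent (i + 1)) \<in> L"
  shows "pos (Y i) \<notin> L"
proof
  assume Y: "pos (Y i) \<in> L"
  show False
  proof (cases "flipped i")
    case False
    then have "Y i = tip i" by (simp add: Y_def)
    then show ?thesis using False assms Y unfolding flipped_def by metis
  next
    case True
    then obtain L' where L': "L' \<in> Ls" "pos (pent i) \<in> L'" "pos (pent (i + 1)) \<in> L'" "pos (X i) \<in> L'"
      unfolding flipped_def by (metis X_def True)
    have "pent i \<noteq> pent (i + 1)" unfolding pent_def by (rule mod5_shift[THEN not_sym]) simp_all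
    then have "L' = L" using L' assms lines_eqI arr_vertices(1) by metis
    then show ?thesis using XY_pent_not_collinear L' Y by blast
  qed
qed

lemma pencilI: "L \<in> Ls \<Longrightarrow> pos v \<in> L \<Longrightarrow> L \<in> pencil v"
  by (simp add: pencil_def)

lemma card_pencil_ge2:
  "L1 \<in> pencil v \<Longrightarrow> L2 \<in> pencil v \<Longrightarrow> L1 \<noteq> L2 \<Longrightarrow> 2 \<le> card (pencil v)"
  using card_mono[OF finite_pencil[of v], of "{L1, L2}"] by auto

lemma card_pencil_ge3:
  "L1 \<in> pencil v \<Longrightarrow> L2 \<in> pencil v \<Longrightarrow> L3 \<in> pencil v \<Longrightarrow> L1 \<noteq> L2 \<Longrightarrow> L1 \<noteq> L3 \<Longrightarrow> L2 \<noteq> L3 \<Longrightarrow> 3 \<le> card (pencil v)"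
  using card_mono[OF finite_pencil[of v], of "{L1, L2, L3}"] by auto

lemma card_pencil_ge4:
  "L1 \<in> pencil v \<Longrightarrow> L2 \<in> pencil v \<Longrightarrow> L3 \<in> pencil v \<Longrightarrow> L4 \<in> pencil v \<Longrightarrow> distinct [L1, L2, L3, L4] \<Longrightarrow> 4 \<le> card (pencil v)"
  using card_mono[OF finite_pencil[of v], of "{L1, L2, L3, L4}"] by auto

lemma card_pencil_X_ge: "2 \<le> card (pencil (X i))"
proof -
  obtain L1 where L1: "L1 \<in> Ls" "pos (X i) \<in> L1" "pos (pent i) \<in> L1" using line_of_edge[OF XY_edges(3)] .
  obtain L2 where L2: "L2 \<in> Ls" "pos (X i) \<in> L2" "pos (Y i) \<in> L2" using line_of_edge[OF XY_edges(1)] .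
  have "L1 \<noteq> L2" using XY_pent_not_collinear L1 L2 by blast
  then show ?thesis using card_pencil_ge2 pencilI L1 L2 by blast
qed

lemma card_pencil_Y_ge: "3 \<le> card (pencil (Y i))"
proof -
  obtain L1 where L1: "L1 \<in> Ls" "pos (Y i) \<in> L1" "pos (pent i) \<in> L1" using line_of_edge[OF XY_edges(5)] .
  obtain L2 where L2: "L2 \<in> Ls" "pos (Y i) \<in> L2" "pos (pent (i + 1)) \<in> L2" using line_of_edge[OF XY_edges(6)] .
  obtain L3 where L3: "L3 \<in> Ls" "pos (X i) \<in> L3" "pos (Y i) \<in> L3" using line_of_edge[OF XY_edges(1)] .
  have "L1 \<noteq> L3" "L2 \<noteq> L3" using XY_pent_not_collinear L1 L2 L3 by blast+
  moreover have "L1 \<noteq> L2" using Y_pents_not_collinear L1 L2 by blast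
  ultimately show ?thesis using card_pencil_ge3 pencilI L1 L2 L3 by blast
qed

lemma card_pencil_pent_ge: "3 \<le> card (pencil (pent i))"
proof -
  \<comment> \<open>Here \<open>i + 4\<close> stands for the predecessor of \<open>i\<close> modulo
    5. A pentagon vertex has degree five: the centre and the \<open>mid\<close> and
    \<open>tip\<close> of its two adjacent edges; so two lines cannot carry its edges.\<close>
  have "pent (i + 4 + 1) = pent i" by (simp add: pent_def)
  then have "{pent i, mid (i + 4)} \<in> arr_E" "{pent i, tip (i + 4)} \<in> arr_E"
    using arr_edges(5,7)[of "i + 4"] by auto
  moreover have "mid (i + 4) \<noteq> mid i" "tip (i + 4) \<noteq> tip i"
    using mod5_shift[of 4 i] by (simp_all add: mid_def tip_def)
  moreover have "{pent i, ctr} \<in> arr_E" "{pent i, mid i} \<in> arr_E" "{pent i, tip i} \<in> arr_E"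
    using arr_edges[of i] by (simp_all add: insert_commute)
  ultimately have "card {ctr, mid i, tip i, mid (i + 4), tip (i + 4)} \<le> 2 * card (pencil (pent i))"
    by (intro card_pencil_ge) auto
  then show ?thesis using \<open>mid (i + 4) \<noteq> mid i\<close> \<open>tip (i + 4) \<noteq> tip i\<close> by auto
qed

lemma card_pencil_ctr_ge: "5 \<le> card (pencil ctr)"
proof -
  have "card (pent ` {..<5} \<union> mid ` {..<5}) \<le> 2 * card (pencil ctr)"
    by (intro card_pencil_ge) (auto intro: arr_edges)
  moreover have "card (pent ` {..<5} \<union> mid ` {..<5}) = 10"
    by (simp add: lessThan_nat_numeral lessThan_Suc pent_def mid_def)
  ultimately show ?thesis by simp
qed

abbreviation pairs :: "nat \<Rightarrow> nat" where
  "pairs v \<equiv> card (pencil v) * (card (pencil v) - 1)"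

lemma pairs_lower:
  "20 \<le> pairs ctr" "6 \<le> pairs (pent i)" "2 \<le> pairs (X i)" "6 \<le> pairs (Y i)"
  using pronic_mono[OF card_pencil_ctr_ge] pronic_mono[OF card_pencil_pent_ge]
    pronic_mono[OF card_pencil_X_ge] pronic_mono[OF card_pencil_Y_ge] by simp_all

lemma sum_pairs: "(\<Sum>v\<in>arr_V. pairs v) = pairs ctr + (\<Sum>i<5. pairs (pent i) + (pairs (X i) + pairs (Y i)))"
proof -
  have "pairs (mid i) + pairs (tip i) = pairs (X i) + pairs (Y i)" for i
    by (simp add: X_def Y_def)
  then show ?thesis by (simp only: sum_arr_V)
qed

text \<open>The constant is \<open>6 + 2 + 6\<close> from \<open>pairs_lower\<close>. The index set
  is general because the bound is applied to all five indices and also to four of them.\<close>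

lemma sum_pairs_ge:
  assumes "finite I"
  shows "14 * card I \<le> (\<Sum>i\<in>I. pairs (pent i) + (pairs (X i) + pairs (Y i)))"
proof -
  have "14 \<le> pairs (pent i) + (pairs (X i) + pairs (Y i))" for i
    using pairs_lower(2-4)[of i] by linarith
  then have "(\<Sum>i\<in>I. 14) \<le> (\<Sum>i\<in>I. pairs (pent i) + (pairs (X i) + pairs (Y i)))"
    by (intro sum_mono)
  then show ?thesis by simp
qed

lemma sum_pairs_le: "pairs ctr + (\<Sum>i<5. pairs (pent i) + (pairs (X i) + pairs (Y i))) \<le> 90"
  using sum_pencils_le pronic_mono[OF card_lines] unfolding sum_pairs by simp

text \<open>The lower bounds add up to \<open>20 + 5 * 14 = 90\<close>, the most that ten lines
  allow, so no single term can exceed its own bound.\<close>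

lemma pairs_upper:
  "pairs ctr \<le> 5 * (5 - 1)" "pairs (pent i) \<le> 3 * (3 - 1)" "pairs (X i) \<le> 2 * (2 - 1)" "pairs (Y i) \<le> 3 * (3 - 1)"
proof -
  have "14 * card {..<5::nat} \<le> (\<Sum>i<5. pairs (pent i) + (pairs (X i) + pairs (Y i)))"
    by (rule sum_pairs_ge) simp
  then show "pairs ctr \<le> 5 * (5 - 1)" using sum_pairs_le by simp
  \<comment> \<open>The sum runs over indices below 5, so the index has to be reduced before its
    term is split off.\<close>
  define j where "j = i mod 5"
  have j: "j < 5" "pent j = pent i" "X j = X i" "Y j = Y i"
    by (auto simp: j_def X_def Y_def flipped_def pent_def mid_def tip_def mod_Suc_eq)
  have "14 * card ({..<5} - {j}) \<le> (\<Sum>i\<in>{..<5}-{j}. pairs (pent i) + (pairs (X i) + pairs (Y i)))"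
    by (rule sum_pairs_ge) simp
  then have "pairs (pent j) + (pairs (X j) + pairs (Y j)) \<le> 14"
    using sum_pairs_le pairs_lower(1) j(1)
      sum.remove[of "{..<5}" j "\<lambda>i. pairs (pent i) + (pairs (X i) + pairs (Y i))"] by simp
  then show "pairs (pent i) \<le> 3 * (3 - 1)" "pairs (X i) \<le> 2 * (2 - 1)" "pairs (Y i) \<le> 3 * (3 - 1)"
    using pairs_lower(2-4)[of i] unfolding j by simp_all
qed

lemma card_pencils:
  "card (pencil ctr) = 5" "card (pencil (pent i)) = 3" "card (pencil (X i)) = 2" "card (pencil (Y i)) = 3"
  using pairs_upper[THEN pronic_bound] card_pencil_ctr_ge card_pencil_pent_ge card_pencil_X_ge card_pencil_Y_ge
  by (auto intro!: antisym)

section \<open>Incidences forced by equality in the count\<close>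

lemma crossing:
  assumes "L \<in> Ls" "L' \<in> Ls" "L \<noteq> L'"
  obtains v where "v \<in> arr_V" "pos v \<in> L" "pos v \<in> L'"
proof -
  have "14 * card {..<5::nat} \<le> (\<Sum>i<5. pairs (pent i) + (pairs (X i) + pairs (Y i)))"
    by (rule sum_pairs_ge) simp
  then have "90 \<le> (\<Sum>v\<in>arr_V. pairs v)" using sum_pairs pairs_lower(1) by simp
  then show ?thesis
    using lines_meet_in_vertex[OF _ assms] that pronic_mono[OF card_lines] by auto
qed

lemma card_lines_eq: "card Ls = 10"
proof (rule antisym[OF card_lines])
  have "14 * card {..<5::nat} \<le> (\<Sum>i<5. pairs (pent i) + (pairs (X i) + pairs (Y i)))"
    by (rule sum_pairs_ge) simp
  then have "10 * (10 - 1) \<le> card Ls * (card Ls - 1)"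
    using sum_pencils_le sum_pairs pairs_lower(1) by simp
  then show "10 \<le> card Ls" using pronic_bound[of 10 "card Ls"] by (cases "card Ls \<le> 1") auto
qed

text \<open>The lines carrying the four edges at \<open>mid i\<close>. Triangles of the graph
  separate all pairs except \<open>L0\<close>, \<open>L3\<close>, whose coincidence yields an axis,
  and \<open>L1\<close>, \<open>L2\<close>, whose coincidence yields a side.\<close>

lemma mid_edge_lines:
  obtains L0 L1 L2 L3 where
    "L0 \<in> pencil (mid i)" "pos ctr \<in> L0" "L1 \<in> pencil (mid i)" "pos (pent i) \<in> L1"
    "L2 \<in> pencil (mid i)" "pos (pent (i + 1)) \<in> L2" "L3 \<in> pencil (mid i)" "pos (tip i) \<in> L3"
    "L0 \<noteq> L1" "L0 \<noteq> L2" "L1 \<noteq> L3" "L2 \<noteq> L3"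
proof -
  obtain L0 where L0: "L0 \<in> Ls" "pos ctr \<in> L0" "pos (mid i) \<in> L0" using line_of_edge[OF arr_edges(2)] .
  obtain L1 where L1: "L1 \<in> Ls" "pos (pent i) \<in> L1" "pos (mid i) \<in> L1" using line_of_edge[OF arr_edges(4)] .
  obtain L2 where L2: "L2 \<in> Ls" "pos (pent (i + 1)) \<in> L2" "pos (mid i) \<in> L2" using line_of_edge[OF arr_edges(5)] .
  obtain L3 where L3: "L3 \<in> Ls" "pos (mid i) \<in> L3" "pos (tip i) \<in> L3" using line_of_edge[OF arr_edges(3)] .
  have "L0 \<noteq> L1"
    using no_collinear_triangle[OF arr_edges(1,4,2), of L0] L0 L1 by blast
  moreover have "L0 \<noteq> L2"
    using no_collinear_triangle[OF arr_edges(1,5,2), of L0] L0 L2 by blast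
  moreover have "L1 \<noteq> L3"
    using no_collinear_triangle[OF arr_edges(4,3,6), of L1] L1 L3 by blast
  moreover have "L2 \<noteq> L3"
    using no_collinear_triangle[OF arr_edges(5,3,7), of L2] L2 L3 by blast
  ultimately show ?thesis using that pencilI L0 L1 L2 L3 by metis
qed

lemma pents_ne: "pent i \<noteq> pent (i + 1)" "pent (i + 1) \<noteq> pent i"
  using mod5_shift[of 1 i] by (auto simp: pent_def)

text \<open>If \<open>L0\<close> and \<open>L3\<close> differed, there would be one line too many at
  \<open>mid i\<close>: three where \<open>X i\<close> has two, or four where \<open>Y i\<close> has
  three.\<close>

lemma axis_exists: "\<exists>L\<in>Ls. pos ctr \<in> L \<and> pos (X i) \<in> L \<and> pos (Y i) \<in> L"
proof -
  obtain L0 L1 L2 L3 where L: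
    "L0 \<in> pencil (mid i)" "pos ctr \<in> L0" "L1 \<in> pencil (mid i)" "pos (pent i) \<in> L1"
    "L2 \<in> pencil (mid i)" "pos (pent (i + 1)) \<in> L2" "L3 \<in> pencil (mid i)" "pos (tip i) \<in> L3"
    "L0 \<noteq> L1" "L0 \<noteq> L2" "L1 \<noteq> L3" "L2 \<noteq> L3" by (rule mid_edge_lines)
  have "L0 = L3"
  proof (rule ccontr)
    assume ne: "L0 \<noteq> L3"
    show False
    proof (cases "flipped i")
      case False
      then have "X i = mid i" by (simp add: X_def)
      then show ?thesis using card_pencil_ge3[of L0 "mid i" L1 L3] L ne card_pencils(3)[of i] by simp
    next
      case True
      then have Y: "Y i = mid i" by (simp add: Y_def)
      have "L1 \<noteq> L2" using Y_pents_not_collinear[of L1 i] L Y unfolding pencil_def by auto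
      then show ?thesis using card_pencil_ge4[of L0 "mid i" L1 L2 L3] L ne card_pencils(4)[of i] Y by simp
    qed
  qed
  then have "L0 \<in> Ls" "pos ctr \<in> L0" "pos (mid i) \<in> L0" "pos (tip i) \<in> L0"
    using L unfolding pencil_def by auto
  then show ?thesis unfolding X_def Y_def by (intro bexI[of _ L0]) auto
qed

text \<open>In the flipped case this is the definition; otherwise \<open>mid i\<close> is
  \<open>X i\<close>, and its second line must serve both \<open>pent i\<close> and
  \<open>pent (i + 1)\<close>.\<close>

lemma side_exists: "\<exists>L\<in>Ls. pos (pent i) \<in> L \<and> pos (X i) \<in> L \<and> pos (pent (i + 1)) \<in> L"
proof (cases "flipped i")
  case True
  then show ?thesis using X_def[of i] flipped_def[of i] by auto
next
  case False
  then have X: "X i = mid i" by (simp add: X_def)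
  obtain L0 L1 L2 L3 where L:
    "L0 \<in> pencil (mid i)" "pos ctr \<in> L0" "L1 \<in> pencil (mid i)" "pos (pent i) \<in> L1"
    "L2 \<in> pencil (mid i)" "pos (pent (i + 1)) \<in> L2" "L3 \<in> pencil (mid i)" "pos (tip i) \<in> L3"
    "L0 \<noteq> L1" "L0 \<noteq> L2" "L1 \<noteq> L3" "L2 \<noteq> L3" by (rule mid_edge_lines)
  have "L1 = L2"
    using card_pencil_ge3[of L0 "mid i" L1 L2] L card_pencils(3)[of i] X by fastforce
  then show ?thesis using L X unfolding pencil_def by auto
qed

text \<open>Meaningful for two distinct vertices on a common line of \<open>Ls\<close>, which is
  then unique; \<open>join_eq\<close> is the rule for that case.\<close>

definition join :: "nat \<Rightarrow> nat \<Rightarrow> point set" where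
  "join u v = (THE L. L \<in> Ls \<and> pos u \<in> L \<and> pos v \<in> L)"

lemma join_eq:
  assumes "L \<in> Ls" "u \<in> arr_V" "v \<in> arr_V" "u \<noteq> v" "pos u \<in> L" "pos v \<in> L"
  shows "join u v = L"
  unfolding join_def using assms lines_eqI by (intro the_equality) blast+

definition axis :: "nat \<Rightarrow> point set" where "axis i = join ctr (X i)"
definition side :: "nat \<Rightarrow> point set" where "side i = join (pent i) (pent (i + 1))"
definition spoke :: "nat \<Rightarrow> point set" where "spoke i = join ctr (pent i)"

lemma axis: "axis i \<in> Ls" "pos ctr \<in> axis i" "pos (X i) \<in> axis i" "pos (Y i) \<in> axis i"
  using axis_exists[of i] join_eq[of _ ctr "X i"] unfolding axis_def by auto

lemma side: "side i \<in> Ls" "pos (pent i) \<in> side i" "pos (X i) \<in> side i" "pos (pent (i + 1)) \<in> side i"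
  using side_exists[of i] join_eq[of _ "pent i" "pent (i + 1)"] pents_ne[of i] unfolding side_def by auto

lemma spoke: "spoke i \<in> Ls" "pos ctr \<in> spoke i" "pos (pent i) \<in> spoke i"
proof -
  obtain L where "L \<in> Ls" "pos ctr \<in> L" "pos (pent i) \<in> L" using line_of_edge[OF arr_edges(1)] .
  then show "spoke i \<in> Ls" "pos ctr \<in> spoke i" "pos (pent i) \<in> spoke i"
    using join_eq[of L ctr "pent i"] unfolding spoke_def by auto
qed

lemma pent_not_in_axis: "pos (pent i) \<notin> axis i" "pos (pent (i + 1)) \<notin> axis i"
  using XY_pent_not_collinear[OF axis(1,3,4)] .

lemma ctr_not_in_side: "pos ctr \<notin> side i"
proof
  assume "pos ctr \<in> side i"
  then have "side i = axis i"
    using lines_eqI[of "side i" "axis i" ctr "X i"] side axis by simp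
  then show False using pent_not_in_axis side(2) by metis
qed

lemma periodic [simp]: "X (i + 5) = X i" "Y (i + 5) = Y i" "axis (i + 5) = axis i"
proof -
  have "pent (i + 5) = pent i" "pent (i + 5 + 1) = pent (i + 1)" "mid (i + 5) = mid i" "tip (i + 5) = tip i"
    using mod_add_self2[of "i + 1" 5] by (simp_all add: pent_def mid_def tip_def)
  then show "X (i + 5) = X i" "Y (i + 5) = Y i" "axis (i + 5) = axis i"
    by (simp_all only: axis_def X_def Y_def flipped_def)
qed

lemma shift_ne:
  assumes "0 < k" "k < 5"
  shows "pent (i + k) \<noteq> pent i" "X (i + k) \<noteq> X i" "Y (i + k) \<noteq> Y i" "X (i + k) \<noteq> Y i" "X i \<noteq> Y (i + k)"
proof -
  have "mid (i + k) \<noteq> mid i" "tip (i + k) \<noteq> tip i" "pent (i + k) \<noteq> pent i"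
    using mod5_shift[OF assms, of i] by (auto simp: mid_def tip_def pent_def)
  then show "pent (i + k) \<noteq> pent i" "X (i + k) \<noteq> X i" "Y (i + k) \<noteq> Y i" "X (i + k) \<noteq> Y i" "X i \<noteq> Y (i + k)"
    by (auto simp: X_def Y_def)
qed

lemma joined_to_ctr:
  assumes "v \<in> arr_V"
  shows "\<exists>L\<in>Ls. pos ctr \<in> L \<and> pos v \<in> L"
  using assms
proof (cases rule: arr_V_cases)
  case 1
  then show ?thesis using axis(1,2)[of 0] by auto
next
  case (2 i)
  then show ?thesis using spoke[of i] by auto
next
  case (3 i)
  then have "v = X i \<or> v = Y i" by (simp add: X_def Y_def)
  then show ?thesis using axis[of i] by auto
next
  case (4 i)
  then have "v = X i \<or> v = Y i" by (simp add: X_def Y_def)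
  then show ?thesis using axis[of i] by auto
qed

lemma card_pencil_le3:
  assumes "v \<in> arr_V" "v \<noteq> ctr"
  shows "card (pencil v) \<le> 3"
  using assms
proof (cases rule: arr_V_cases)
  case 1
  then show ?thesis using assms by blast
next
  case (2 i)
  then show ?thesis using card_pencils by simp
next
  case (3 i)
  then have "v = X i \<or> v = Y i" by (simp add: X_def Y_def)
  then show ?thesis using card_pencils(3,4)[of i] by auto
next
  case (4 i)
  then have "v = X i \<or> v = Y i" by (simp add: X_def Y_def)
  then show ?thesis using card_pencils(3,4)[of i] by auto
qed

text \<open>A line avoiding the centre carries at most five vertices, since the five lines at the centre
  separate them. If it carried both \<open>X i\<close> and \<open>X (i + 1)\<close>, then at most \<open>1 + 1 + 3 * 2 = 8\<close> other
  lines would meet it in a vertex, but there are nine.\<close>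

lemma sides_ne: "side i \<noteq> side (i + 1)"
proof
  assume eq: "side i = side (i + 1)"
  define W where "W = {v \<in> arr_V. pos v \<in> side i}"
  have fin: "finite W" using finite_V by (simp add: W_def)
  have ctr: "ctr \<notin> W" using ctr_not_in_side by (simp add: W_def)
  have join: "join ctr v \<in> pencil ctr \<and> pos v \<in> join ctr v" if "v \<in> W" for v
  proof -
    have v: "v \<in> arr_V" "ctr \<noteq> v" using that ctr by (auto simp: W_def)
    then obtain L where L: "L \<in> Ls" "pos ctr \<in> L" "pos v \<in> L" using joined_to_ctr by blast
    then have "join ctr v = L" using join_eq v by simp
    then show ?thesis using L pencilI by simp
  qed
  have "inj_on (join ctr) W"
  proof (rule inj_onI, rule ccontr)
    fix u v assume uv: "u \<in> W" "v \<in> W" "join ctr u = join ctr v" "u \<noteq> v"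
    then have "side i = join ctr u"
      using join[of u] join[of v] side(1) by (intro lines_eqI[of _ _ u v]) (auto simp: W_def pencil_def)
    then show False using join[OF uv(1)] ctr_not_in_side[of i] by (simp add: pencil_def)
  qed
  then have W5: "card W \<le> 5"
    using card_inj_on_le[of "join ctr" W "pencil ctr"] join finite_pencil card_pencils(1) by auto
  have X: "X i \<in> W" "X (i + 1) \<in> W" "X i \<noteq> X (i + 1)"
    using side(3)[of i] side(3)[of "i + 1"] eq shift_ne(2)[of 1 i] by (auto simp: W_def)
  have "Ls - {side i} \<subseteq> (\<Union>v\<in>W. pencil v - {side i})"
  proof
    fix L assume L: "L \<in> Ls - {side i}"
    then obtain v where "v \<in> arr_V" "pos v \<in> side i" "pos v \<in> L"
      using crossing[of "side i" L] side(1) by blast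
    then show "L \<in> (\<Union>v\<in>W. pencil v - {side i})"
      using L by (auto simp: W_def pencil_def)
  qed
  then have "card (Ls - {side i}) \<le> card (\<Union>v\<in>W. pencil v - {side i})"
    using fin finite_pencil by (intro card_mono) auto
  also have "\<dots> \<le> (\<Sum>v\<in>W. card (pencil v - {side i}))"
    by (rule card_UN_le[OF fin])
  also have "\<dots> = (\<Sum>v\<in>W. card (pencil v) - 1)"
    using side(1) by (intro sum.cong refl) (simp add: W_def pencil_def)
  also have "\<dots> = (\<Sum>v\<in>W - {X i, X (i + 1)}. card (pencil v) - 1) + (\<Sum>v\<in>{X i, X (i + 1)}. card (pencil v) - 1)"
    using X fin by (intro sum.subset_diff) auto
  also have "\<dots> \<le> (\<Sum>v\<in>W - {X i, X (i + 1)}. 2) + 2"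
  proof (rule add_mono)
    show "(\<Sum>v\<in>W - {X i, X (i + 1)}. card (pencil v) - 1) \<le> (\<Sum>v\<in>W - {X i, X (i + 1)}. 2)"
    proof (rule sum_mono)
      fix v assume "v \<in> W - {X i, X (i + 1)}"
      then have "card (pencil v) \<le> 3" using ctr by (intro card_pencil_le3) (auto simp: W_def)
      then show "card (pencil v) - 1 \<le> 2" by simp
    qed
    show "(\<Sum>v\<in>{X i, X (i + 1)}. card (pencil v) - 1) \<le> 2"
      using X card_pencils(3) by simp
  qed
  also have "\<dots> \<le> 8" using W5 X fin by (simp add: card_Diff_subset)
  finally show False using card_lines_eq side(1) finite_lines by simp
qed

section \<open>Crossings of the sides and the five lines at the centre\<close>

lemma lines_at_pent:
  assumes "L \<in> Ls" "pos (pent (i + 1)) \<in> L"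
  shows "L = side i \<or> L = side (i + 1) \<or> L = spoke (i + 1)"
proof (rule ccontr)
  assume "\<not> ?thesis"
  moreover have "spoke (i + 1) \<noteq> side i" "spoke (i + 1) \<noteq> side (i + 1)"
    using spoke ctr_not_in_side by metis+
  ultimately have "4 \<le> card (pencil (pent (i + 1)))"
    using assms side(1,4)[of i] side(1,2)[of "i + 1"] spoke[of "i + 1"] sides_ne[of i]
    by (intro card_pencil_ge4[of L _ "side i" "side (i + 1)" "spoke (i + 1)"] pencilI) auto
  then show False using card_pencils by simp
qed

text \<open>Only three lines pass through \<open>pent (i + 1)\<close>. The edge to
  \<open>Y i\<close> cannot follow \<open>side i\<close>, which misses \<open>Y i\<close>, nor the
  spoke, which would coincide with \<open>axis i\<close> and put a pentagon vertex on it. The second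
  claim is the mirror image.\<close>

lemma Y_in_sides: "pos (Y i) \<in> side (i + 1)" "pos (Y (i + 1)) \<in> side i"
proof -
  obtain L where L: "L \<in> Ls" "pos (Y i) \<in> L" "pos (pent (i + 1)) \<in> L"
    using line_of_edge[OF XY_edges(6)] .
  have "L \<noteq> side i" using Y_pents_not_collinear side L by blast
  moreover have "L \<noteq> spoke (i + 1)"
  proof
    assume "L = spoke (i + 1)"
    then have "L = axis i" using lines_eqI[of L "axis i" ctr "Y i"] L spoke axis by simp
    then show False using L pent_not_in_axis by blast
  qed
  ultimately show "pos (Y i) \<in> side (i + 1)" using lines_at_pent[OF L(1,3)] L by blast
next
  obtain L where L: "L \<in> Ls" "pos (Y (i + 1)) \<in> L" "pos (pent (i + 1)) \<in> L"
    using line_of_edge[OF XY_edges(5)] .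
  have "L \<noteq> side (i + 1)" using Y_pents_not_collinear side L by blast
  moreover have "L \<noteq> spoke (i + 1)"
  proof
    assume "L = spoke (i + 1)"
    then have "L = axis (i + 1)" using lines_eqI[of L "axis (i + 1)" ctr "Y (i + 1)"] L spoke axis by simp
    then show False using L pent_not_in_axis by blast
  qed
  ultimately show "pos (Y (i + 1)) \<in> side i" using lines_at_pent[OF L(1,3)] L by blast
qed

text \<open>A side avoids the centre, so a line through the centre meets it at most once.\<close>

lemma separated:
  assumes "K \<in> Ls" "pos ctr \<in> K" "u \<in> arr_V" "v \<in> arr_V" "u \<noteq> v"
    and "pos u \<in> side j" "pos v \<in> side j" "pos u \<in> K" "pos v \<in> K'"
  shows "K \<noteq> K'"
  using lines_eqI[of K "side j" u v] side(1) ctr_not_in_side assms by blast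

text \<open>\<open>side (i + 1)\<close> carries the five vertices \<open>Y i\<close>,
  \<open>X (i + 1)\<close>, \<open>Y (i + 2)\<close>, \<open>pent (i + 1)\<close> and
  \<open>pent (i + 2)\<close>. Lines joining them to the centre are distinct, and the centre has
  only five lines.\<close>

lemma five_lines_at_ctr:
  "distinct [axis i, axis (i + 1), axis (i + 2), spoke (i + 1), spoke (i + 2)]"
  "pencil ctr = {axis i, axis (i + 1), axis (i + 2), spoke (i + 1), spoke (i + 2)}"
proof -
  have *: "pos (Y i) \<in> side (i + 1)" "pos (X (i + 1)) \<in> side (i + 1)" "pos (Y (i + 2)) \<in> side (i + 1)"
    "pos (pent (i + 1)) \<in> side (i + 1)" "pos (pent (i + 2)) \<in> side (i + 1)"
    using Y_in_sides(1)[of i] Y_in_sides(2)[of "i + 1"] side[of "i + 1"] by (simp_all add: numeral_2_eq_2)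
  have ne: "Y (i + 2) \<noteq> Y i" "pent (i + 2) \<noteq> pent (i + 1)" "X (i + 1) \<noteq> Y i" "X (i + 1) \<noteq> Y (i + 2)"
    using shift_ne(3)[of 2 i] pents_ne[of "i + 1"] shift_ne(4)[of 1 i] shift_ne(5)[of 1 "i + 1"]
    by (simp_all add: numeral_2_eq_2)
  have "axis i \<noteq> axis (i + 1)" by (rule separated[of _ "Y i" "X (i + 1)" "i + 1"]) (use * ne axis in auto)
  moreover have "axis i \<noteq> axis (i + 2)" by (rule separated[of _ "Y i" "Y (i + 2)" "i + 1"]) (use * ne axis in auto)
  moreover have "axis (i + 1) \<noteq> axis (i + 2)" by (rule separated[of _ "X (i + 1)" "Y (i + 2)" "i + 1"]) (use * ne axis in auto)
  moreover have "axis i \<noteq> spoke (i + 1)" by (rule separated[of _ "Y i" "pent (i + 1)" "i + 1"]) (use * ne axis spoke in auto)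
  moreover have "axis i \<noteq> spoke (i + 2)" by (rule separated[of _ "Y i" "pent (i + 2)" "i + 1"]) (use * ne axis spoke in auto)
  moreover have "axis (i + 1) \<noteq> spoke (i + 1)" by (rule separated[of _ "X (i + 1)" "pent (i + 1)" "i + 1"]) (use * ne axis spoke in auto)
  moreover have "axis (i + 1) \<noteq> spoke (i + 2)" by (rule separated[of _ "X (i + 1)" "pent (i + 2)" "i + 1"]) (use * ne axis spoke in auto)
  moreover have "axis (i + 2) \<noteq> spoke (i + 1)" by (rule separated[of _ "Y (i + 2)" "pent (i + 1)" "i + 1"]) (use * ne axis spoke in auto)
  moreover have "axis (i + 2) \<noteq> spoke (i + 2)" by (rule separated[of _ "Y (i + 2)" "pent (i + 2)" "i + 1"]) (use * ne axis spoke in auto)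
  moreover have "spoke (i + 1) \<noteq> spoke (i + 2)" by (rule separated[of _ "pent (i + 1)" "pent (i + 2)" "i + 1"]) (use * ne spoke in auto)
  ultimately show d: "distinct [axis i, axis (i + 1), axis (i + 2), spoke (i + 1), spoke (i + 2)]" by simp
  show "pencil ctr = {axis i, axis (i + 1), axis (i + 2), spoke (i + 1), spoke (i + 2)}"
  proof (rule card_subset_eq[symmetric, OF finite_pencil])
    show "{axis i, axis (i + 1), axis (i + 2), spoke (i + 1), spoke (i + 2)} \<subseteq> pencil ctr"
      using axis spoke by (simp add: pencil_def)
    show "card {axis i, axis (i + 1), axis (i + 2), spoke (i + 1), spoke (i + 2)} = card (pencil ctr)"
      using d card_pencils(1) by (simp add: card_insert_if)
  qed
qed

lemma axes_ne: "axis i \<noteq> axis (i + 1)" "axis i \<noteq> axis (i + 2)"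
  using five_lines_at_ctr(1)[of i] by simp_all

text \<open>The five axes are pairwise distinct as well, so the last two must be the two spokes
  among the five lines at the centre.\<close>

lemma spokes_are_axes: "{spoke (i + 1), spoke (i + 2)} = {axis (i + 3), axis (i + 4)}"
proof -
  have "axis (i + 3) \<noteq> axis i" "axis (i + 4) \<noteq> axis i" "axis (i + 4) \<noteq> axis (i + 1)"
    using axes_ne(2)[of "i + 3"] axes_ne(1)[of "i + 4"] axes_ne(2)[of "i + 4"] periodic(3)[of i] periodic(3)[of "i + 1"]
    by (simp_all add: numeral_eq_Suc)
  moreover have "axis (i + 3) \<noteq> axis (i + 1)" "axis (i + 3) \<noteq> axis (i + 2)" "axis (i + 4) \<noteq> axis (i + 2)" "axis (i + 3) \<noteq> axis (i + 4)"
    using axes_ne(2)[of "i + 1"] axes_ne(1)[of "i + 2"] axes_ne(2)[of "i + 2"] axes_ne(1)[of "i + 3"]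
    by (simp_all add: numeral_eq_Suc)
  moreover have "axis (i + 3) \<in> pencil ctr" "axis (i + 4) \<in> pencil ctr"
    using axis by (simp_all add: pencil_def)
  ultimately show ?thesis using axes_ne unfolding five_lines_at_ctr(2)[of i] by (elim insertE emptyE) (simp_all add: insert_commute)
qed

text \<open>The spoke belongs to two consecutive instances of \<open>spokes_are_axes\<close>, whose
  right-hand sides have only \<open>axis (i + 4)\<close> in common.\<close>

lemma spoke_eq_axis: "spoke (i + 2) = axis (i + 4)"
proof -
  have "{spoke (i + 2), spoke (i + 3)} = {axis (i + 4), axis (i + 5)}"
    using spokes_are_axes[of "i + 1"] by (simp add: numeral_eq_Suc)
  moreover have "axis (i + 3) \<noteq> axis (i + 5)" using axes_ne(2)[of "i + 3"] by (simp add: numeral_eq_Suc)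
  ultimately show ?thesis using spokes_are_axes[of i] by (auto simp: doubleton_eq_iff)
qed

text \<open>\<open>axis i\<close> passes through \<open>pent (i + 3)\<close>, where
  \<open>side (i + 2)\<close> and \<open>side (i + 3)\<close> cross, and through \<open>Y i\<close>,
  where \<open>side (i + 4)\<close> and \<open>side (i + 1)\<close> cross.\<close>

lemma dual_sides_parallel:
  assumes "\<And>i z. z \<in> side i \<Longrightarrow> a i * (fst z - fst (pos ctr)) + b i * (snd z - snd (pos ctr)) = 1"
  shows "(a (i + 2) - a (i + 3)) * (b (i + 4) - b (i + 1)) = (b (i + 2) - b (i + 3)) * (a (i + 4) - a (i + 1))"
proof (rule dual_parallel[OF lines[OF axis(1)[of i]] axis(2), where z = "pos (pent (i + 3))" and z' = "pos (Y i)"])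
  show "pos (Y i) \<in> axis i" by (rule axis(4))
  show "pos (pent (i + 3)) \<in> axis i"
  proof -
    have "i + 1 + 2 = i + 3" "i + 1 + 4 = i + 5" by simp_all
    then have "spoke (i + 3) = axis i" using spoke_eq_axis[of "i + 1"] periodic(3)[of i] by metis
    then show ?thesis using spoke(3)[of "i + 3"] by simp
  qed
  have "pos (pent (i + 3)) \<in> side (i + 2)" "pos (pent (i + 3)) \<in> side (i + 3)"
    using side(4)[of "i + 2"] side(2)[of "i + 3"] by (simp_all add: numeral_eq_Suc)
  then show "a (i + 2) * (fst (pos (pent (i + 3))) - fst (pos ctr)) + b (i + 2) * (snd (pos (pent (i + 3))) - snd (pos ctr)) = 1"
    "a (i + 3) * (fst (pos (pent (i + 3))) - fst (pos ctr)) + b (i + 3) * (snd (pos (pent (i + 3))) - snd (pos ctr)) = 1"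
    using assms by blast+
  have "pos (Y i) \<in> side (i + 4)" "pos (Y i) \<in> side (i + 1)"
    using Y_in_sides(2)[of "i + 4"] Y_in_sides(1)[of i] periodic(2)[of i] by (simp_all add: numeral_eq_Suc)
  then show "a (i + 4) * (fst (pos (Y i)) - fst (pos ctr)) + b (i + 4) * (snd (pos (Y i)) - snd (pos ctr)) = 1"
    "a (i + 1) * (fst (pos (Y i)) - fst (pos ctr)) + b (i + 1) * (snd (pos (Y i)) - snd (pos ctr)) = 1"
    using assms by blast+
qed

theorem irrational_coordinate:
  "\<exists>v\<in>arr_V. fst (pos v) \<notin> \<rat> \<or> snd (pos v) \<notin> \<rat>"
proof (rule ccontr)
  assume "\<not> ?thesis"
  then have rat: "fst (pos v) \<in> \<rat>" "snd (pos v) \<in> \<rat>" if "v \<in> arr_V" for v using that by auto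
  have "\<exists>a b. a \<in> \<rat> \<and> b \<in> \<rat> \<and> side i = {z. a * (fst z - fst (pos ctr)) + b * (snd z - snd (pos ctr)) = 1}" for i
  proof (rule rational_dual_coordinates[OF lines[OF side(1)[of i]] ctr_not_in_side side(2,4)])
    show "pos (pent i) \<noteq> pos (pent (i + 1))" using pents_ne pos_eq_iff by simp
  qed (use rat in auto)
  then have "\<forall>i. \<exists>a b. a \<in> \<rat> \<and> b \<in> \<rat> \<and> side i = {z. a * (fst z - fst (pos ctr)) + b * (snd z - snd (pos ctr)) = 1}"
    by blast
  from choice[OF this] obtain a0 where "\<forall>i. \<exists>b. a0 i \<in> \<rat> \<and> b \<in> \<rat> \<and>
      side i = {z. a0 i * (fst z - fst (pos ctr)) + b * (snd z - snd (pos ctr)) = 1}"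
    by blast
  from choice[OF this] obtain b0 where ab0: "\<forall>i. a0 i \<in> \<rat> \<and> b0 i \<in> \<rat> \<and>
      side i = {z. a0 i * (fst z - fst (pos ctr)) + b0 i * (snd z - snd (pos ctr)) = 1}"
    by blast
  \<comment> \<open>Taking the chosen values at \<open>i mod 5\<close> makes the coordinates
    periodic by construction.\<close>
  define a b where ab: "a i = a0 (i mod 5)" "b i = b0 (i mod 5)" for i
  have "side (i mod 5) = side i" for i
    by (simp add: side_def pent_def mod_Suc_eq)
  then have side_eq: "side i = {z. a i * (fst z - fst (pos ctr)) + b i * (snd z - snd (pos ctr)) = 1}"
    and rat_ab: "a i \<in> \<rat>" "b i \<in> \<rat>" for i
    using ab0[rule_format, of "i mod 5"] unfolding ab by simp_all
  note par = dual_sides_parallel[of a b, OF side_eq[THEN equalityD1, THEN subsetD, simplified mem_Collect_eq]]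
  have ab_red: "a 5 = a 0" "b 5 = b 0" "a 6 = a 1" "b 6 = b 1" "a 7 = a 2" "b 7 = b 2"
    by (simp_all add: ab)
  define x0 y0 x1 y1 where xy: "x0 = fst (pos (pent 0)) - fst (pos ctr)" "y0 = snd (pos (pent 0)) - snd (pos ctr)"
    "x1 = fst (pos (pent 1)) - fst (pos ctr)" "y1 = snd (pos (pent 1)) - snd (pos ctr)"
  have pent5: "pent 5 = pent 0" by (simp add: pent_def)
  have sides: "side 5 = side 0" "side 0 \<noteq> side 1" "side 4 \<noteq> side 0"
    using sides_ne[of 0] sides_ne[of 4] \<open>\<And>i. side (i mod 5) = side i\<close>[of 5] by simp_all
  have in_side: "pos (pent 0) \<in> side 0" "pos (pent 1) \<in> side 0" "pos (pent 1) \<in> side 1" "pos (pent 0) \<in> side 4"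
    using side(2)[of 0] side(4)[of 0] side(2)[of 1] side(4)[of 4] pent5 by simp_all
  have p01: "pent 0 \<noteq> pent 1" by (simp add: pent_def)
  have notin: "pos (pent 0) \<notin> side 1" "pos (pent 1) \<notin> side 4"
    using lines_eqI[of "side 0" _ "pent 0" "pent 1"] side(1) in_side sides(2,3) p01 arr_vertices(1) by metis+
  have eqs: "a 0 * x0 + b 0 * y0 = 1" "a 0 * x1 + b 0 * y1 = 1" "a 1 * x1 + b 1 * y1 = 1" "a 4 * x0 + b 4 * y0 = 1"
    "a 1 * x0 + b 1 * y0 \<noteq> 1" "a 4 * x1 + b 4 * y1 \<noteq> 1"
    using in_side notin unfolding side_eq xy by simp_all
  show False
  proof (rule no_rational_affine_regular_pentagon[of a b])
    show "(a 1 - a 0) * (b 4 - b 0) \<noteq> (b 1 - b 0) * (a 4 - a 0)"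
    proof
      assume "(a 1 - a 0) * (b 4 - b 0) = (b 1 - b 0) * (a 4 - a 0)"
      \<comment> \<open>Product rule for determinants: the product is the determinant of the
        assumption times \<open>x0 * y1 - x1 * y0\<close>, because \<open>pent 0\<close> lies on
        sides 0 and 4 and \<open>pent 1\<close> on sides 0 and 1.\<close>
      then have "(a 1 * x0 + b 1 * y0 - 1) * (a 4 * x1 + b 4 * y1 - 1) = 0"
        using eqs(1-4) by algebra
      then show False using eqs(5,6) by simp
    qed
  qed (use par[of 0] par[of 1] par[of 2] par[of 3] rat_ab in \<open>simp_all add: ab_red del: One_nat_def add_2_eq_Suc add_2_eq_Suc'\<close>)
qed

end

section \<open>A drawing on ten lines\<close>

lemma straight_line_drawing_imp_planar:
  assumes G: "simple_graph V E" and D: "straight_line_drawing V E pos"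
  shows "planar_graph V E"
proof -
  \<comment> \<open>An ordered pair of ends for each edge, since \<open>linepath\<close> needs an
    orientation.\<close>
  have "\<forall>e\<in>E. \<exists>p. fst p \<noteq> snd p \<and> fst p \<in> V \<and> snd p \<in> V \<and> e = {fst p, snd p}"
    using G unfolding simple_graph_def by (metis fst_conv snd_conv)
  then obtain f where f: "\<And>e. e \<in> E \<Longrightarrow> fst (f e) \<noteq> snd (f e) \<and> fst (f e) \<in> V \<and> snd (f e) \<in> V \<and> e = {fst (f e), snd (f e)}"
    by metis
  define \<gamma> where "\<gamma> e = linepath (pos (fst (f e))) (pos (snd (f e)))" for e
  have inj: "inj_on pos V" using D by (simp add: straight_line_drawing_def)
  have img: "pos ` e = {pos (fst (f e)), pos (snd (f e))}" if "e \<in> E" for e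
    using f[OF that] by (metis image_empty image_insert)
  have seg: "path_image (\<gamma> e) = edge_seg pos e" if "e \<in> E" for e
    unfolding \<gamma>_def edge_seg_def img[OF that] by (simp add: segment_convex_hull)
  have sub: "pos ` e \<subseteq> edge_seg pos e" for e
    unfolding edge_seg_def by (rule hull_subset)
  show ?thesis
    unfolding planar_graph_def
  proof (intro exI[of _ pos] exI[of _ \<gamma>] conjI ballI impI inj)
    fix e assume e: "e \<in> E"
    have "pos (fst (f e)) \<noteq> pos (snd (f e))" using f[OF e] inj by (meson inj_on_eq_iff)
    then show "arc (\<gamma> e)" by (simp add: \<gamma>_def arc_linepath)
    show "{pathstart (\<gamma> e), pathfinish (\<gamma> e)} = pos ` e" by (simp add: \<gamma>_def img[OF e])
    have "e \<subseteq> V" using f[OF e] by (metis empty_subsetI insert_subset)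
    moreover have "w \<in> e" if "w \<in> V" "pos w \<in> edge_seg pos e" for w
      using D e that unfolding straight_line_drawing_def by simp
    ultimately show "path_image (\<gamma> e) \<inter> pos ` V = pos ` e"
      using sub[of e] unfolding seg[OF e] by auto
  next
    fix e1 e2 assume "e1 \<in> E" "e2 \<in> E" "e1 \<noteq> e2"
    then show "path_image (\<gamma> e1) \<inter> path_image (\<gamma> e2) \<subseteq> pos ` (e1 \<inter> e2)"
      using D seg unfolding straight_line_drawing_def by simp
  qed
qed

text \<open>Each line lists its vertices in the order of a common linear functional \<open>h\<close>.\<close>

locale arrangement_drawing =
  fixes V :: "nat set" and E :: "nat set set" and pos :: "nat \<Rightarrow> point"
    and n :: nat and line_at :: "nat \<Rightarrow> point set" and W :: "nat \<Rightarrow> nat list" and h :: "point \<Rightarrow> real"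
  assumes inj: "inj_on pos V"
    and h: "linear h"
    and lines: "\<And>i. i < n \<Longrightarrow> line (line_at i)"
    and on_line: "\<And>i v. i < n \<Longrightarrow> v \<in> V \<Longrightarrow> pos v \<in> line_at i \<longleftrightarrow> v \<in> set (W i)"
    and W_V: "\<And>i. i < n \<Longrightarrow> set (W i) \<subseteq> V"
    and sorted: "\<And>i. i < n \<Longrightarrow> sorted_wrt (\<lambda>a b. h (pos a) < h (pos b)) (W i)"
    and edges: "\<And>e. e \<in> E \<Longrightarrow> \<exists>i<n. \<exists>k. Suc k < length (W i) \<and> e = {W i ! k, W i ! Suc k}"
    and meet: "\<And>i j. i < n \<Longrightarrow> j < n \<Longrightarrow> set (W i) \<inter> set (W j) \<noteq> {}"
    and differ: "\<And>i j. i < n \<Longrightarrow> j < n \<Longrightarrow> i \<noteq> j \<Longrightarrow> \<not> set (W i) \<subseteq> set (W j)"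
begin

lemma nth_V: "i < n \<Longrightarrow> k < length (W i) \<Longrightarrow> W i ! k \<in> V"
  using W_V nth_mem by blast

lemma h_less_iff:
  assumes "i < n" "k < length (W i)" "m < length (W i)"
  shows "h (pos (W i ! k)) < h (pos (W i ! m)) \<longleftrightarrow> k < m"
proof -
  have "h (pos (W i ! k)) < h (pos (W i ! m))" if "k < m" "m < length (W i)" for k m
    using sorted_wrt_nth_less[OF sorted[OF assms(1)] that] .
  then show ?thesis using assms by (metis linorder_less_linear order_less_asym order_less_irrefl)
qed

lemma h_segment:
  assumes "x \<in> closed_segment a b" "h a < h b"
  shows "h a \<le> h x" "h x \<le> h b" "h x = h b \<Longrightarrow> x = b"
proof -
  obtain t where t: "0 \<le> t" "t \<le> 1" "x = (1 - t) *\<^sub>R a + t *\<^sub>R b"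
    using assms(1) by (auto simp: closed_segment_def)
  have hx: "h x = (1 - t) * h a + t * h b"
    unfolding t(3) using h by (simp add: linear_add linear_scale)
  have "0 \<le> t * (h b - h a)" "0 \<le> (1 - t) * (h b - h a)" using t assms(2) by simp_all
  then show "h a \<le> h x" "h x \<le> h b" by (simp_all add: hx algebra_simps)
  assume "h x = h b"
  then have "(1 - t) * (h b - h a) = 0" by (simp add: hx algebra_simps)
  then have "t = 1" using assms(2) by simp
  then show "x = b" by (simp add: t(3))
qed

lemma edge_on_line:
  assumes "i < n" "Suc k < length (W i)"
  shows "closed_segment (pos (W i ! k)) (pos (W i ! Suc k)) \<subseteq> line_at i"
  using assms nth_V[of i] on_line[of i] lines by (intro closed_segment_subset_line) auto

lemma vertex_on_edge:
  assumes "i < n" "Suc k < length (W i)" "w \<in> V"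
    and "pos w \<in> closed_segment (pos (W i ! k)) (pos (W i ! Suc k))"
  shows "w \<in> {W i ! k, W i ! Suc k}"
proof -
  have "w \<in> set (W i)" using on_line edge_on_line assms by blast
  then obtain m where m: "m < length (W i)" "w = W i ! m" by (metis in_set_conv_nth)
  have "h (pos (W i ! k)) < h (pos (W i ! Suc k))"
    using h_less_iff assms by simp
  then have "\<not> m < k" "\<not> Suc k < m"
    using h_segment(1,2)[OF assms(4)] h_less_iff[OF assms(1)] m assms(2)
    by (metis Suc_lessD not_less)+
  then have "m = k \<or> m = Suc k" by arith
  then show ?thesis using m by auto
qed

text \<open>On one line the edges occupy intervals of \<open>h\<close> between neighbouring
  vertices; two of them overlap only if they are consecutive, and then only at the vertex between
  them.\<close>

lemma same_line_edges:
  assumes i: "i < n" "Suc k < length (W i)" "Suc m < length (W i)" "k < m"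
    and x: "x \<in> closed_segment (pos (W i ! k)) (pos (W i ! Suc k))"
      "x \<in> closed_segment (pos (W i ! m)) (pos (W i ! Suc m))"
  shows "x \<in> pos ` ({W i ! k, W i ! Suc k} \<inter> {W i ! m, W i ! Suc m})"
proof -
  have less: "h (pos (W i ! k)) < h (pos (W i ! Suc k))" "h (pos (W i ! m)) < h (pos (W i ! Suc m))"
    using h_less_iff i by simp_all
  have "h x \<le> h (pos (W i ! Suc k))" "h (pos (W i ! m)) \<le> h x"
    using h_segment[OF x(1) less(1)] h_segment[OF x(2) less(2)] by simp_all
  moreover have "h (pos (W i ! Suc k)) < h (pos (W i ! m)) \<longleftrightarrow> Suc k < m"
    using h_less_iff i by simp
  ultimately have m: "m = Suc k" "h x = h (pos (W i ! Suc k))"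
    using i(4) by (cases "m = Suc k"; simp)+
  then show ?thesis using h_segment(3)[OF x(1) less(1)] by simp
qed

text \<open>Two lines with different vertex lists are different, and by \<open>meet\<close> they
  already share a vertex, which is therefore their only common point.\<close>

lemma crossing_at_vertex:
  assumes "i < n" "j < n" "i \<noteq> j" "x \<in> line_at i" "x \<in> line_at j"
  obtains w where "w \<in> V" "x = pos w"
proof -
  obtain w where w: "w \<in> set (W i)" "w \<in> set (W j)" using meet assms by blast
  then have wV: "w \<in> V" "pos w \<in> line_at i" "pos w \<in> line_at j" using W_V on_line assms by blast+
  have "x = pos w"
  proof (rule ccontr)
    assume "x \<noteq> pos w"
    then have "line_at i = line_at j"
      using line_eqI[of "line_at i" "line_at j" x "pos w"] lines assms wV by blast
    then have "set (W i) \<subseteq> set (W j)" using on_line W_V assms by blast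
    then show False using differ assms by blast
  qed
  then show ?thesis using that wV by blast
qed

lemma drawing: "straight_line_drawing V E pos"
  unfolding straight_line_drawing_def
proof (intro conjI ballI impI inj subsetI)
  fix e w assume "e \<in> E" "w \<in> V" "pos w \<in> edge_seg pos e"
  moreover obtain i k where "i < n" "Suc k < length (W i)" "e = {W i ! k, W i ! Suc k}"
    using edges[OF \<open>e \<in> E\<close>] by blast
  ultimately show "w \<in> e" using vertex_on_edge by (simp add: edge_seg_doubleton)
next
  fix e1 e2 x assume e: "e1 \<in> E" "e2 \<in> E" "e1 \<noteq> e2" "x \<in> edge_seg pos e1 \<inter> edge_seg pos e2"
  obtain i k where i: "i < n" "Suc k < length (W i)" "e1 = {W i ! k, W i ! Suc k}"
    using edges[OF e(1)] by blast
  obtain j m where j: "j < n" "Suc m < length (W j)" "e2 = {W j ! m, W j ! Suc m}"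
    using edges[OF e(2)] by blast
  have x: "x \<in> closed_segment (pos (W i ! k)) (pos (W i ! Suc k))" "x \<in> closed_segment (pos (W j ! m)) (pos (W j ! Suc m))"
    using e(4) i(3) j(3) by (simp_all add: edge_seg_doubleton)
  show "x \<in> pos ` (e1 \<inter> e2)"
  proof (cases "i = j")
    case True
    have "k \<noteq> m" using True i j e(3) by blast
    then consider "k < m" | "m < k" by linarith
    then show ?thesis
    proof cases
      case 1
      then show ?thesis using same_line_edges[of i k m x] i j x True by simp
    next
      case 2
      then show ?thesis using same_line_edges[of i m k x] i j x True by (simp add: Int_commute)
    qed
  next
    case False
    then obtain w where w: "w \<in> V" "x = pos w"
      using crossing_at_vertex[of i j x] edge_on_line i j x by blast
    then have "w \<in> e1 \<inter> e2" using vertex_on_edge i j x by blast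
    then show ?thesis using w by blast
  qed
qed

lemma on_lines:
  assumes "V \<subseteq> (\<Union>i<n. set (W i))"
  shows "on_k_lines V E pos (card (line_at ` {..<n}))"
  unfolding on_k_lines_def
proof (intro exI[of _ "line_at ` {..<n}"] conjI ballI)
  show "pos ` V \<subseteq> \<Union> (line_at ` {..<n})" using assms on_line by blast
  fix e assume "e \<in> E"
  then obtain i k where "i < n" "Suc k < length (W i)" "e = {W i ! k, W i ! Suc k}"
    using edges by blast
  then show "edge_seg pos e \<subseteq> \<Union> (line_at ` {..<n})"
    using edge_on_line[of i k] by (auto simp: edge_seg_doubleton)
qed (use lines in auto)

end

section \<open>Exact arithmetic with the golden ratio and the explicit drawing\<close>

definition inv_phi :: real where
  "inv_phi = (sqrt 5 - 1) / 2"

text \<open>Elements of the ring generated by the reciprocal golden ratio, given by integer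
  coefficients, so that questions about incidence become integer computations.\<close>

definition gold :: "int \<Rightarrow> int \<Rightarrow> real" where
  "gold a b = of_int a + of_int b * inv_phi"

lemma inv_phi_square: "inv_phi * inv_phi = 1 - inv_phi"
  by (simp add: inv_phi_def field_simps)

lemma gold_add: "gold a b + gold c d = gold (a + c) (b + d)"
  by (simp add: gold_def algebra_simps)

lemma gold_mult: "gold a b * gold c d = gold (a * c + b * d) (a * d + b * c - b * d)"
proof -
  have "gold a b * gold c d =
    of_int a * of_int c + (of_int a * of_int d + of_int b * of_int c) * inv_phi + of_int b * of_int d * (inv_phi * inv_phi)"
    by (simp add: gold_def algebra_simps)
  also have "\<dots> = gold (a * c + b * d) (a * d + b * c - b * d)"
    unfolding inv_phi_square by (simp add: gold_def algebra_simps)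
  finally show ?thesis .
qed

lemma inv_phi_irrational: "inv_phi \<notin> \<rat>"
proof
  assume "inv_phi \<in> \<rat>"
  then have "inv_phi + 1 \<in> \<rat>" by simp
  moreover have "(inv_phi + 1)\<^sup>2 = (inv_phi + 1) + 1"
    using inv_phi_square by (simp add: power2_eq_square algebra_simps)
  ultimately show False by (rule no_rational_golden_ratio)
qed

lemma gold_eq_iff: "gold a b = gold c d \<longleftrightarrow> a = c \<and> b = d"
proof
  assume eq: "gold a b = gold c d"
  have "b = d"
  proof (rule ccontr)
    assume "b \<noteq> d"
    then have "inv_phi = of_int (c - a) / of_int (b - d)"
      using eq by (simp add: gold_def divide_simps algebra_simps)
    then show False using inv_phi_irrational by (metis Rats_divide Rats_of_int)
  qed
  then show "a = c \<and> b = d" using eq by (simp add: gold_def)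
qed simp

lemma gold_zero_iff: "gold a b = 0 \<longleftrightarrow> a = 0 \<and> b = 0"
  using gold_eq_iff[of a b 0 0] by (simp add: gold_def)

text \<open>The fractions \<open>3/5\<close> and \<open>5/8\<close> enclose \<open>inv_phi\<close>, and a linear function
  that is positive at both ends is positive in between.\<close>

lemma gold_lessI:
  assumes "5 * a + 3 * b < 5 * c + 3 * d" "8 * a + 5 * b < 8 * c + 5 * d"
  shows "gold a b < gold c d"
proof -
  have "11 / 5 < sqrt 5" by (rule real_less_rsqrt) (simp add: power2_eq_square)
  then have g1: "3 / 5 < inv_phi" by (simp add: inv_phi_def)
  have "sqrt 5 < 9 / 4" by (rule real_less_lsqrt) (simp_all add: power2_eq_square)
  then have g2: "inv_phi < 5 / 8" by (simp add: inv_phi_def)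
  define p q where "p = real_of_int c - real_of_int a" "q = real_of_int d - real_of_int b"
  note pq = this
  have "real_of_int (5 * a + 3 * b) < real_of_int (5 * c + 3 * d)" "real_of_int (8 * a + 5 * b) < real_of_int (8 * c + 5 * d)"
    using assms by (simp_all only: of_int_less_iff)
  then have "0 < 5 * p + 3 * q" "0 < 8 * p + 5 * q" by (simp_all add: pq)
  have "0 < p + q * inv_phi"
  proof (cases "0 \<le> q")
    case True
    then have "q * (3 / 5) \<le> q * inv_phi" using g1 by (intro mult_left_mono) auto
    then show ?thesis using \<open>0 < 5 * p + 3 * q\<close> by simp
  next
    case False
    then have "q * (5 / 8) \<le> q * inv_phi" using g2 by (intro mult_left_mono_neg) auto
    then show ?thesis using \<open>0 < 8 * p + 5 * q\<close> by simp
  qed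
  then show ?thesis by (simp add: gold_def pq algebra_simps)
qed

text \<open>The regular pentagon, its edge midpoints and the tips of its pentagram, up to a linear map:
  an entry \<open>((a, b), (c, d))\<close> is the point \<open>(gold a b, gold c d)\<close>.\<close>

definition arr_coords :: "((int \<times> int) \<times> (int \<times> int)) list" where
  "arr_coords =
    [((2, 0), (0, 0)), ((0, 0), (2, 0)), ((-2, 0), (0, 2)), ((0, -2), (0, -2)), ((0, 2), (-2, 0)),
     ((1, 0), (1, 0)), ((-1, 0), (1, 1)), ((-1, -1), (0, 0)), ((0, 0), (-1, -1)), ((1, 1), (-1, 0)),
     ((2, 2), (2, 2)), ((-2, -2), (4, 2)), ((-4, -2), (0, 0)), ((0, 0), (-4, -2)), ((4, 2), (-2, -2)),
     ((0, 0), (0, 0))]"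

definition arr_pos :: "nat \<Rightarrow> point" where
  "arr_pos v = (case arr_coords ! v of ((a, b), (c, d)) \<Rightarrow> (gold a b, gold c d))"

text \<open>An entry \<open>((a, b), (c, d), (e, f))\<close> is the line
  \<open>gold a b * x + gold c d * y + gold e f = 0\<close>.\<close>

definition arr_eqns :: "((int \<times> int) \<times> (int \<times> int) \<times> (int \<times> int)) list" where
  "arr_eqns =
    [((1, 0), (1, 0), (-2, 0)), ((-1, 1), (1, 0), (-2, 0)), ((2, 0), (0, 1), (2, 2)),
     ((0, 1), (2, 0), (2, 2)), ((1, 0), (-1, 1), (-2, 0)),
     ((1, 0), (-1, 0), (0, 0)), ((1, 0), (0, 1), (0, 0)), ((0, 0), (1, 0), (0, 0)),
     ((1, 0), (0, 0), (0, 0)), ((0, 1), (1, 0), (0, 0))]"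

definition arr_line :: "nat \<Rightarrow> point set" where
  "arr_line i = (case arr_eqns ! i of ((a, b), (c, d), (e, f)) \<Rightarrow>
     {z. gold a b * fst z + gold c d * snd z + gold e f = 0})"

text \<open>The first five rows are the sides, the last five the axes; each row is ordered by
  increasing \<open>arr_height\<close>.\<close>

definition arr_rows :: "nat list list" where
  "arr_rows =
    [[11, 1, 5, 0, 14], [12, 2, 6, 1, 10], [13, 3, 7, 2, 11], [12, 3, 8, 4, 14], [13, 4, 9, 0, 10],
     [3, 15, 5, 10], [11, 6, 15, 4], [12, 7, 15, 0], [13, 8, 15, 1], [2, 15, 9, 14]]"

text \<open>The line equation at the point, split by \<open>gold_mult\<close> into its coefficients
  of 1 and of \<open>inv_phi\<close>; both must vanish because \<open>inv_phi\<close> is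
  irrational.\<close>

definition arr_on :: "nat \<Rightarrow> nat \<Rightarrow> bool" where
  "arr_on i v = (case arr_eqns ! i of ((a, b), (c, d), (e, f)) \<Rightarrow> case arr_coords ! v of ((p, q), (r, s)) \<Rightarrow>
     a * p + b * q + (c * r + d * s) + e = 0 \<and> a * q + b * p - b * q + (c * s + d * r - d * s) + f = 0)"

lemma arr_on: "arr_pos v \<in> arr_line i \<longleftrightarrow> arr_on i v"
  by (simp add: arr_line_def arr_pos_def arr_on_def gold_mult gold_add gold_zero_iff split: prod.split)

text \<open>A functional with small integer coefficients that is constant on none of the ten
  lines.\<close>

definition arr_height :: "point \<Rightarrow> real" where
  "arr_height z = 2 * fst z + snd z"

text \<open>The two integer inequalities of \<open>gold_lessI\<close> for the heights: a sufficient
  test that can be evaluated.\<close>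

definition arr_less :: "nat \<Rightarrow> nat \<Rightarrow> bool" where
  "arr_less v w = (case arr_coords ! v of ((a, b), (c, d)) \<Rightarrow> case arr_coords ! w of ((p, q), (r, s)) \<Rightarrow>
     5 * (2 * a + c) + 3 * (2 * b + d) < 5 * (2 * p + r) + 3 * (2 * q + s) \<and>
     8 * (2 * a + c) + 5 * (2 * b + d) < 8 * (2 * p + r) + 5 * (2 * q + s))"

lemma arr_less: "arr_less v w \<Longrightarrow> arr_height (arr_pos v) < arr_height (arr_pos w)"
proof -
  have "arr_height (gold a b, gold c d) = gold (2 * a + c) (2 * b + d)" for a b c d
    by (simp add: arr_height_def gold_def algebra_simps)
  then show "arr_less v w \<Longrightarrow> arr_height (arr_pos v) < arr_height (arr_pos w)"
    by (auto simp: arr_pos_def arr_less_def split: prod.splits intro!: gold_lessI)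
qed

lemma arr_lines: "i < 10 \<Longrightarrow> line (arr_line i)"
proof -
  assume i: "i < 10"
  have chk: "\<forall>i\<in>set [0..<10]. (case arr_eqns ! i of ((a, b), (c, d), (e, f)) \<Rightarrow> \<not> (a = 0 \<and> b = 0) \<or> \<not> (c = 0 \<and> d = 0))"
    by code_simp
  obtain a b c d e f where eqn: "arr_eqns ! i = ((a, b), (c, d), (e, f))"
    by (metis prod.exhaust)
  have "i \<in> set [0..<10]" using i by simp
  from bspec[OF chk this] have "\<not> (a = 0 \<and> b = 0) \<or> \<not> (c = 0 \<and> d = 0)"
    by (simp only: eqn prod.case)
  have "arr_line i = {z. gold a b * fst z + gold c d * snd z = - gold e f}"
    by (auto simp: arr_line_def eqn add_eq_0_iff2)
  then show ?thesis using \<open>\<not> (a = 0 \<and> b = 0) \<or> \<not> (c = 0 \<and> d = 0)\<close> line_of_equation[of "gold a b" "gold c d"] by (simp add: gold_zero_iff)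
qed

lemma arr_edges_in_rows:
  "e \<in> arr_E \<Longrightarrow> \<exists>i<10. \<exists>k. Suc k < length (arr_rows ! i) \<and> e = {arr_rows ! i ! k, arr_rows ! i ! Suc k}"
proof -
  \<comment> \<open>Edges are checked as ordered pairs of numbers, so that evaluation involves lists
    only; a row may traverse an edge in either direction.\<close>
  have chk: "\<forall>j\<in>set [0..<5]. \<forall>(u, v)\<in>set [(ctr, pent j), (ctr, mid j), (mid j, tip j), (pent j, mid j),
     (pent (j + 1), mid j), (pent j, tip j), (pent (j + 1), tip j)].
     \<exists>i\<in>set [0..<10]. \<exists>k\<in>set [0..<length (arr_rows ! i) - 1].
       u = arr_rows ! i ! k \<and> v = arr_rows ! i ! Suc k \<or> v = arr_rows ! i ! k \<and> u = arr_rows ! i ! Suc k"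
    by code_simp
  assume "e \<in> arr_E"
  then obtain j u v where "j < 5" "e = {u, v}" "(u, v) \<in> set [(ctr, pent j), (ctr, mid j), (mid j, tip j), (pent j, mid j),
     (pent (j + 1), mid j), (pent j, tip j), (pent (j + 1), tip j)]"
    unfolding arr_E_def by auto
  then have "\<exists>i\<in>set [0..<10]. \<exists>k\<in>set [0..<length (arr_rows ! i) - 1].
       u = arr_rows ! i ! k \<and> v = arr_rows ! i ! Suc k \<or> v = arr_rows ! i ! k \<and> u = arr_rows ! i ! Suc k"
    using bspec[OF bspec[OF chk, of j], of "(u, v)"] by (simp only: prod.case set_upt atLeastLessThan_iff simp_thms le0)
  then obtain i k where ik: "i \<in> set [0..<10]" "k \<in> set [0..<length (arr_rows ! i) - 1]"
    "u = arr_rows ! i ! k \<and> v = arr_rows ! i ! Suc k \<or> v = arr_rows ! i ! k \<and> u = arr_rows ! i ! Suc k"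
    by blast
  then have "i < 10" "Suc k < length (arr_rows ! i)" by auto
  moreover have "e = {arr_rows ! i ! k, arr_rows ! i ! Suc k}"
    using ik(3) \<open>e = {u, v}\<close> by (metis insert_commute)
  ultimately show ?thesis by blast
qed

lemma arr_V_upt: "arr_V = set [0..<16]"
  by (auto simp: arr_V_def)

interpretation arr: arrangement_drawing arr_V arr_E arr_pos 10 arr_line "\<lambda>i. arr_rows ! i" arr_height
proof (rule arrangement_drawing.intro)
  have "\<forall>v\<in>set [0..<16]. \<forall>w\<in>set [0..<16]. arr_coords ! v = arr_coords ! w \<longrightarrow> v = w" by code_simp
  moreover have "arr_coords ! v = arr_coords ! w" if "arr_pos v = arr_pos w" for v w
    using that by (auto simp: arr_pos_def gold_eq_iff split: prod.splits)
  ultimately show "inj_on arr_pos arr_V" unfolding arr_V_upt inj_on_def by blast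
  show "linear arr_height" by (rule linearI) (auto simp: arr_height_def algebra_simps)
  show "line (arr_line i)" if "i < 10" for i using arr_lines that .
  have "\<forall>i\<in>set [0..<10]. \<forall>v\<in>set [0..<16]. arr_on i v \<longleftrightarrow> v \<in> set (arr_rows ! i)" by code_simp
  then show "arr_pos v \<in> arr_line i \<longleftrightarrow> v \<in> set (arr_rows ! i)" if "i < 10" "v \<in> arr_V" for i v
    using that by (simp add: arr_on arr_V_def)
  have "\<forall>i\<in>set [0..<10]. \<forall>v\<in>set (arr_rows ! i). v < 16" by code_simp
  then show "set (arr_rows ! i) \<subseteq> arr_V" if "i < 10" for i using that by (auto simp: arr_V_def)
  have rows_sorted: "\<forall>i\<in>set [0..<10]. sorted_wrt arr_less (arr_rows ! i)" by code_simp
  show "sorted_wrt (\<lambda>a b. arr_height (arr_pos a) < arr_height (arr_pos b)) (arr_rows ! i)" if "i < 10" for i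
  proof (rule sorted_wrt_mono_rel[of _ arr_less])
    show "sorted_wrt arr_less (arr_rows ! i)" using that rows_sorted by simp
  qed (rule arr_less)
  show "\<exists>i<10. \<exists>k. Suc k < length (arr_rows ! i) \<and> e = {arr_rows ! i ! k, arr_rows ! i ! Suc k}" if "e \<in> arr_E" for e
    using arr_edges_in_rows that .
  have meet: "\<forall>i\<in>set [0..<10]. \<forall>j\<in>set [0..<10]. \<exists>v\<in>set (arr_rows ! i). v \<in> set (arr_rows ! j)" by code_simp
  show "set (arr_rows ! i) \<inter> set (arr_rows ! j) \<noteq> {}" if "i < 10" "j < 10" for i j
    using bspec[OF bspec[OF meet, of i], of j] that by auto
  have differ: "\<forall>i\<in>set [0..<10]. \<forall>j\<in>set [0..<10]. i \<noteq> j \<longrightarrow> (\<exists>v\<in>set (arr_rows ! i). v \<notin> set (arr_rows ! j))" by code_simp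
  show "\<not> set (arr_rows ! i) \<subseteq> set (arr_rows ! j)" if "i < 10" "j < 10" "i \<noteq> j" for i j
    using bspec[OF bspec[OF differ, of i], of j] that by auto
qed

lemma rho12_arr_le: "rho12 arr_V arr_E \<le> 10"
proof -
  have "\<forall>v\<in>set [0..<16]. \<exists>i\<in>set [0..<10]. v \<in> set (arr_rows ! i)" by code_simp
  then have "arr_V \<subseteq> (\<Union>i<10. set (arr_rows ! i))" unfolding arr_V_upt by fastforce
  then have "rho12 arr_V arr_E \<le> card (arr_line ` {..<10})"
    unfolding rho12_def using arr.drawing arr.on_lines by (intro Least_le) blast
  also have "\<dots> \<le> 10" using card_image_le[of "{..<10::nat}" arr_line] by simp
  finally show ?thesis .
qed

theorem theorem4p1:
  shows "\<exists>(V :: nat set) (E :: nat set set). simple_graph V E \<and> planar_graph V E \<and>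
    (\<forall>pos. straight_line_drawing V E pos \<and> on_k_lines V E pos (rho12 V E) \<longrightarrow>
       (\<exists>v\<in>V. fst (pos v) \<notin> \<rat> \<or> snd (pos v) \<notin> \<rat>))"
proof (intro exI[of _ arr_V] exI[of _ arr_E] conjI allI impI)
  show "simple_graph arr_V arr_E" by (rule arr_simple_graph)
  show "planar_graph arr_V arr_E"
    using straight_line_drawing_imp_planar[OF arr_simple_graph arr.drawing] .
  fix pos assume *: "straight_line_drawing arr_V arr_E pos \<and> on_k_lines arr_V arr_E pos (rho12 arr_V arr_E)"
  then obtain Ls where Ls: "finite Ls" "card Ls = rho12 arr_V arr_E" "\<forall>L\<in>Ls. line L"
    "\<forall>e\<in>arr_E. edge_seg pos e \<subseteq> \<Union>Ls"
    unfolding on_k_lines_def by blast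
  \<comment> \<open>The minimality in \<open>rho12\<close> enters only as the bound
    \<open>rho12_arr_le\<close>.\<close>
  interpret ten_line_cover pos Ls
    using * Ls arr_simple_graph rho12_arr_le by unfold_locales auto
  show "\<exists>v\<in>arr_V. fst (pos v) \<notin> \<rat> \<or> snd (pos v) \<notin> \<rat>"
    by (rule irrational_coordinate)
qed

end
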